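(* Let $K$ be any field and let $F=(F_1,F_2)$ be a polynomial automorphism of the plane over $K$ (an invertible polynomial map in $K[X_1,X_2]^2$) with $F(0)=0$. Then $\det J_F\in K^*$ and there exist Pascal finite automorphisms $P_1,\dots,P_s$ of the plane over $K$ such that $$F=\operatorname{diag}(\det J_F,1)\circ P_1\circ\dots\circ P_s .$$ Moreover, the factors can be chosen so that each $P_i$ is either a linear transvection or a linear conjugate $W^{-1}\circ U\circ W$, with $W\in \mathrm{GL}_2(K)$, of a map $U=(X_1+q(X_2),\,X_2+c)$ with $q\in K[X_2]$, $c\in K$; and, if $\operatorname{char}K=p>0$, so that in addition each $P_i$ has (compositional) order dividing $p^2$.
   Context: Let $K$ be a field, $X=(X_1,\dots,X_n)$ (here $n=2$). A polynomial map is a tuple $F=(F_1,\dots,F_n)\in K[X]^n$; it is invertible (a polynomial automorphism) if there is $G\in K[X]^n$ with $F\circ G=G\circ F=(X_1,\dots,X_n)$. Composition is functional: $(F\circ G)(X)=F(G(X))$. Polynomial automorphisms are identified with $K$-algebra automorphisms of $K[X]$ via $F\mapsto\sigma_F$, $\sigma_F(P)=P\circ F$. $J_F=(\partial F_i/\partial X_j)$ is the Jacobian matrix. Put $\Delta_F=\sigma_F-\mathrm{Id}$, i.e. $\Delta_F(P)=P\circ F-P$ for $P\in K[X]$. $F$ is Pascal finite if there is an integer $m\ge 1$ with $\Delta_F^m(X_i)=0$ for all $i=1,\dots,n$. For $\delta\in K^*$, $\operatorname{diag}(\delta,1)$ denotes the linear automorphism $(X_1,X_2)\mapsto(\delta X_1,X_2)$.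 A linear transvection is a linear map $v\mapsto v+\varphi(v)u$ with $\varphi$ a linear form and $u$ a vector with $\varphi(u)=0$, e.g. $(X_1+\lambda X_2,X_2)$. *)

theory Defs
  imports "HOL-Analysis.Analysis" "HOL-Computational_Algebra.Computational_Algebra"
begin

text \<open>
  The ring \<open>K[X\<^sub>1, X\<^sub>2]\<close> is \<open>'a poly poly\<close>: \<open>X\<^sub>1\<close> is the variable of the inner
  polynomials and \<open>X\<^sub>2\<close> that of the outer ones. A polynomial map of the plane is a pair
  of such polynomials.
\<close>

type_synonym 'a bpoly = "'a poly poly"
type_synonym 'a pmap = "'a bpoly ^ 2"

definition const2 :: "'a::field \<Rightarrow> 'a bpoly" where
  "const2 c = [:[:c:]:]"

definition X\<^sub>1 :: "'a::field bpoly" where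
  "X\<^sub>1 = [:[:0, 1:]:]"

definition X\<^sub>2 :: "'a::field bpoly" where
  "X\<^sub>2 = [:0, 1:]"

definition id_pmap :: "'a::field pmap" where
  "id_pmap = vector [X\<^sub>1, X\<^sub>2]"

definition eval2 :: "'a::field bpoly \<Rightarrow> 'a ^ 2 \<Rightarrow> 'a" where
  "eval2 P x = poly (poly P [:x $ 2:]) (x $ 1)"

definition eval_pmap :: "'a::field pmap \<Rightarrow> 'a ^ 2 \<Rightarrow> 'a ^ 2" where
  "eval_pmap F x = (\<chi> i. eval2 (F $ i) x)"

text \<open>The substitution \<open>P(F\<^sub>1, F\<^sub>2)\<close>.\<close>

definition subst2 :: "'a::field bpoly \<Rightarrow> 'a pmap \<Rightarrow> 'a bpoly" where
  "subst2 P F = poly (map_poly (\<lambda>p. poly (map_poly const2 p) (F $ 1)) P) (F $ 2)"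

definition comp_pmap :: "'a::field pmap \<Rightarrow> 'a pmap \<Rightarrow> 'a pmap" (infixr \<open>\<circ>\<^sub>P\<close> 55) where
  "F \<circ>\<^sub>P G = (\<chi> i. subst2 (F $ i) G)"

definition pmap_automorphism :: "'a::field pmap \<Rightarrow> bool" where
  "pmap_automorphism F \<longleftrightarrow> (\<exists>G. F \<circ>\<^sub>P G = id_pmap \<and> G \<circ>\<^sub>P F = id_pmap)"

definition pmap_power :: "'a::field pmap \<Rightarrow> nat \<Rightarrow> 'a pmap" where
  "pmap_power F k = ((\<lambda>G. F \<circ>\<^sub>P G) ^^ k) id_pmap"

definition partial2 :: "2 \<Rightarrow> 'a::field bpoly \<Rightarrow> 'a bpoly" where
  "partial2 j P = (if j = 1 then map_poly pderiv P else pderiv P)"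

definition jacobian_pmap :: "'a::field pmap \<Rightarrow> 'a bpoly ^ 2 ^ 2" where
  "jacobian_pmap F = (\<chi> i j. partial2 j (F $ i))"

definition Delta :: "'a::field pmap \<Rightarrow> 'a bpoly \<Rightarrow> 'a bpoly" where
  "Delta F P = subst2 P F - P"

definition pascal_finite :: "'a::field pmap \<Rightarrow> bool" where
  "pascal_finite F \<longleftrightarrow> (\<exists>m\<ge>1. \<forall>i. (Delta F ^^ m) (id_pmap $ i) = 0)"

definition linear_pmap :: "'a::field ^ 2 ^ 2 \<Rightarrow> 'a pmap" where
  "linear_pmap A = (\<chi> i. \<Sum>j\<in>UNIV. const2 (A $ i $ j) * id_pmap $ j)"

definition diag_pmap :: "'a::field \<Rightarrow> 'a \<Rightarrow> 'a pmap" where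
  "diag_pmap a b = vector [const2 a * X\<^sub>1, const2 b * X\<^sub>2]"

text \<open>The map \<open>v \<mapsto> v + \<phi>(v) u\<close>, where \<open>\<phi>\<close> is the linear form with coefficient vector \<open>f\<close>.\<close>

definition linear_transvection :: "'a::field pmap \<Rightarrow> bool" where
  "linear_transvection P \<longleftrightarrow> (\<exists>f u :: 'a ^ 2. (\<Sum>j\<in>UNIV. f $ j * u $ j) = 0 \<and>
     P = (\<chi> i. id_pmap $ i + (\<Sum>j\<in>UNIV. const2 (f $ j) * id_pmap $ j) * const2 (u $ i)))"

text \<open>The map \<open>(X\<^sub>1 + q(X\<^sub>2), X\<^sub>2 + c)\<close>.\<close>

definition triangular_pmap :: "'a::field poly \<Rightarrow> 'a \<Rightarrow> 'a pmap" where
  "triangular_pmap q c = vector [X\<^sub>1 + poly (map_poly const2 q) X\<^sub>2, X\<^sub>2 + const2 c]"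

definition conj_triangular :: "'a::field pmap \<Rightarrow> bool" where
  "conj_triangular P \<longleftrightarrow> (\<exists>(W :: 'a ^ 2 ^ 2) q c. invertible W \<and>
     P = linear_pmap (matrix_inv W) \<circ>\<^sub>P triangular_pmap q c \<circ>\<^sub>P linear_pmap W)"

end

theory Submission
  imports Defs "Berlekamp_Zassenhaus.Unique_Factorization_Poly"
begin

text \<open>
  The core is a reduction of degree that works in every characteristic. Give \<open>X\<^sub>1\<close> and \<open>X\<^sub>2\<close>
  positive weights and let \<open>(f, g)\<close> be an automorphism, so that \<open>K[X\<^sub>1, X\<^sub>2] = K[f][g]\<close>. Let \<open>P\<close> be a
  nonconstant homogeneous divisor of least degree of the leading form of \<open>f\<close>; it is prime, and the
  weighted degree of \<open>h\<close> together with the multiplicity of \<open>P\<close> in the leading form of \<open>h\<close> is a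
  valuation of rank two. Choose \<open>\<phi>\<close> of least degree in \<open>g\<close> among the elements whose value is not
  proportional to that of \<open>f\<close>. Pseudo-division by \<open>\<phi>\<close> shows that every \<open>h\<close> satisfies
  \<open>c h = a \<phi>\<^sup>i\<close> up to lower terms, where the values of \<open>c\<close> and \<open>a\<close> are proportional to that of \<open>f\<close>.

  Hence the values of all \<open>h\<close> lie on one side of the line through the value of \<open>f\<close>. Applied to \<open>P\<close> and
  to the cofactor of the power of \<open>P\<close> in the leading form of \<open>f\<close>, this shows that the leading form is
  \<open>c P\<^sup>k\<close>. If \<open>P\<close> had no linear part, then modulo \<open>P\<close> both \<open>X\<^sub>1\<close> and \<open>X\<^sub>2\<close> would be scalar multiples of
  powers of one and the same polynomial, which is impossible in degree one; so \<open>P\<close> has a linear part.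

  With the weights \<open>deg\<^sub>2 f \<ge> deg\<^sub>1 f\<close> of \<open>X\<^sub>1\<close> and \<open>X\<^sub>2\<close> the leading form of \<open>f\<close> must therefore be
  \<open>c (\<alpha> X\<^sub>1 + \<beta> X\<^sub>2\<^sup>s)\<^sup>k\<close>, and the substitution \<open>X\<^sub>1 \<mapsto> X\<^sub>1 - (\<beta> / \<alpha>) X\<^sub>2\<^sup>s\<close> lowers \<open>deg\<^sub>2 f\<close>. The diagonal
  factors are finally moved to the front, because conjugation by a linear map preserves linear
  conjugates of triangular maps.
\<close>

section \<open>Substitution homomorphisms\<close>

no_notation fps_nth (infixl "$" 75)
no_notation Matrix.vec_index (infixl "$" 100)
hide_const (open) Determinant.det Matrix.mat

text \<open>The coefficient of \<open>X\<^sub>1 ^ i * X\<^sub>2 ^ j\<close>: the first index belongs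
  to the inner variable, so the nested coefficients are read in reverse order.\<close>

definition bcoeff :: "'a::zero poly poly \<Rightarrow> nat \<Rightarrow> nat \<Rightarrow> 'a" where
  "bcoeff P i j = coeff (coeff P j) i"

lemma bcoeff_simps [simp]:
  "bcoeff 0 i j = 0" "bcoeff (P + Q) i j = bcoeff P i j + bcoeff Q i j"
  "bcoeff (R - S) i j = bcoeff R i j - bcoeff S i j"
  for P Q :: "'a::comm_monoid_add poly poly" and R S :: "'b::ab_group_add poly poly"
  by (simp_all add: bcoeff_def)

lemma bpoly_eqI: "(\<And>i j. bcoeff P i j = bcoeff Q i j) \<Longrightarrow> P = Q"
  by (simp add: bcoeff_def poly_eq_iff)

lemma bcoeff_monom: "bcoeff (monom (monom c i) j) k l = (if k = i \<and> l = j then c else 0)"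
  by (simp add: bcoeff_def)

lemma bpoly_additive_induct:
  fixes P :: "'a::comm_monoid_add poly poly"
  assumes monom: "\<And>c i j. Q (monom (monom c i) j)"
    and add: "\<And>p q. Q p \<Longrightarrow> Q q \<Longrightarrow> Q (p + q)"
  shows "Q P"
proof -
  have sum: "finite A \<Longrightarrow> (\<And>i. i \<in> A \<Longrightarrow> Q (f i)) \<Longrightarrow> Q (sum f A)" for A :: "nat set" and f
  proof (induction A rule: finite_induct)
    case empty
    then show ?case using monom[of 0 0 0] by simp
  next
    case (insert x F)
    then show ?case using add[of "f x" "sum f F"] by simp
  qed
  have row: "Q (monom p j)" for p j
  proof -
    have "monom p j = monom (\<Sum>i\<le>degree p. monom (coeff p i) i) j"
      by (simp add: poly_as_sum_of_monoms)
    also have "\<dots> = (\<Sum>i\<le>degree p. monom (monom (coeff p i) i) j)"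
      by (simp add: monom_hom.hom_sum)
    also have "Q \<dots>" by (intro sum monom) simp
    finally show ?thesis .
  qed
  have "P = (\<Sum>j\<le>degree P. monom (coeff P j) j)" by (simp add: poly_as_sum_of_monoms)
  also have "Q \<dots>" by (intro sum row) simp
  finally show ?thesis .
qed

lemma const2_0 [simp]: "const2 0 = 0" and const2_1 [simp]: "const2 1 = 1"
  and const2_eq_0_iff [simp]: "const2 a = 0 \<longleftrightarrow> a = 0"
  by (auto simp: const2_def)

lemma const2_add: "const2 (a + b) = const2 a + const2 b"
  and const2_mult: "const2 (a * b) = const2 a * const2 b"
  and const2_uminus: "const2 (- a) = - const2 a"
  and const2_diff: "const2 (a - b) = const2 a - const2 b"
  by (simp_all add: const2_def)

lemma comm_ring_hom_const2: "comm_ring_hom const2"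
  by unfold_locales (simp_all add: const2_add const2_mult)

lemma X1_power: "X\<^sub>1 ^ i = [:monom 1 i:]"
proof (induction i)
  case (Suc i)
  then show ?case by (simp add: X\<^sub>1_def monom_Suc)
qed (simp only: power_0 monom_eq_1 pCons_one)

lemma bpoly_monom_eq: "monom (monom c i) j = const2 c * X\<^sub>1 ^ i * X\<^sub>2 ^ j"
  unfolding X1_power by (simp add: monom_altdef[of _ j] const2_def X\<^sub>2_def smult_monom)

lemma bpoly_induct [case_names const X1 X2 add mult]:
  assumes "\<And>c. Q (const2 c)" "Q X\<^sub>1" "Q X\<^sub>2"
    and "\<And>p q. Q p \<Longrightarrow> Q q \<Longrightarrow> Q (p + q)" and "\<And>p q. Q p \<Longrightarrow> Q q \<Longrightarrow> Q (p * q)"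
  shows "Q P"
proof -
  have pow: "Q p \<Longrightarrow> Q (p ^ n)" for p n
    by (induction n) (use assms(1)[of 1] assms in auto)
  show ?thesis
    by (rule bpoly_additive_induct) (use assms pow in \<open>auto simp: bpoly_monom_eq\<close>)
qed

section \<open>Homomorphisms out of the polynomial ring\<close>

lemma bpoly_hom_unique:
  assumes "comm_ring_hom \<phi>" "comm_ring_hom \<psi>"
    and "\<And>c. \<phi> (const2 c) = \<psi> (const2 c)" "\<phi> X\<^sub>1 = \<psi> X\<^sub>1" "\<phi> X\<^sub>2 = \<psi> X\<^sub>2"
  shows "\<phi> P = \<psi> P"
proof -
  interpret \<phi>: comm_ring_hom \<phi> by fact
  interpret \<psi>: comm_ring_hom \<psi> by fact
  show ?thesis by (induction P rule: bpoly_induct) (simp_all add: assms \<phi>.hom_add \<psi>.hom_add \<phi>.hom_mult \<psi>.hom_mult)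
qed

lemma map_poly_const: "f 0 = 0 \<Longrightarrow> map_poly f [:a:] = [:f a:]"
  by (simp add: poly_eq_iff coeff_map_poly coeff_pCons split: nat.split)

text \<open>The target ring is arbitrary because both \<open>subst2\<close> and the weighted grading
  are instances and share the homomorphism laws.\<close>

definition bpoly_eval :: "('a::field \<Rightarrow> 'b::comm_ring_1) \<Rightarrow> 'b \<Rightarrow> 'b \<Rightarrow> 'a bpoly \<Rightarrow> 'b" where
  "bpoly_eval \<kappa> s t P = poly (map_poly (\<lambda>p. poly (map_poly \<kappa> p) s) P) t"

lemma comm_ring_hom_map_poly:
  assumes "comm_ring_hom \<kappa>"
  shows "comm_ring_hom (map_poly \<kappa>)"
proof -
  interpret comm_ring_hom \<kappa> by fact
  have "map_poly \<kappa> (p + q) = map_poly \<kappa> p + map_poly \<kappa> q" for p q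
    by (simp add: poly_eq_iff coeff_map_poly hom_add)
  moreover have "map_poly \<kappa> (p * q) = map_poly \<kappa> p * map_poly \<kappa> q" for p q
    by (simp add: poly_eq_iff coeff_map_poly coeff_mult hom_sum hom_mult)
  ultimately show ?thesis by unfold_locales simp_all
qed

lemma comm_ring_hom_poly_map_poly:
  assumes "comm_ring_hom \<kappa>"
  shows "comm_ring_hom (\<lambda>p. poly (map_poly \<kappa> p) s)"
proof -
  interpret comm_ring_hom "map_poly \<kappa>" by (rule comm_ring_hom_map_poly[OF assms])
  show ?thesis by unfold_locales (simp_all add: hom_add hom_mult)
qed

lemma comm_ring_hom_bpoly_eval:
  "comm_ring_hom \<kappa> \<Longrightarrow> comm_ring_hom (bpoly_eval \<kappa> s t)"
  unfolding bpoly_eval_def[abs_def] by (intro comm_ring_hom_poly_map_poly)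

lemma bpoly_eval_gens:
  assumes "comm_ring_hom \<kappa>"
  shows "bpoly_eval \<kappa> s t (const2 c) = \<kappa> c" "bpoly_eval \<kappa> s t X\<^sub>1 = s" "bpoly_eval \<kappa> s t X\<^sub>2 = t"
proof -
  interpret comm_ring_hom \<kappa> by fact
  interpret inner: comm_ring_hom "\<lambda>p. poly (map_poly \<kappa> p) s"
    by (intro comm_ring_hom_poly_map_poly assms)
  show "bpoly_eval \<kappa> s t (const2 c) = \<kappa> c" "bpoly_eval \<kappa> s t X\<^sub>1 = s" "bpoly_eval \<kappa> s t X\<^sub>2 = t"
    by (simp_all add: bpoly_eval_def const2_def X\<^sub>1_def X\<^sub>2_def map_poly_pCons map_poly_const)
qed

lemma comm_ring_hom_subst2: "comm_ring_hom (\<lambda>P. subst2 P F)"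
  using comm_ring_hom_bpoly_eval[OF comm_ring_hom_const2, of "F $ 1" "F $ 2"]
  by (simp add: bpoly_eval_def[abs_def] subst2_def)

interpretation subst2: comm_ring_hom "\<lambda>P. subst2 P F" by (rule comm_ring_hom_subst2)

lemma subst2_gens [simp]: "subst2 (const2 c) F = const2 c" "subst2 X\<^sub>1 F = F $ 1" "subst2 X\<^sub>2 F = F $ 2"
  using bpoly_eval_gens[OF comm_ring_hom_const2, of "F $ 1" "F $ 2"]
  by (simp_all add: bpoly_eval_def subst2_def)

lemma id_pmap_nth [simp]: "id_pmap $ 1 = X\<^sub>1" "id_pmap $ 2 = X\<^sub>2"
  by (simp_all add: id_pmap_def)

lemma comp_pmap_nth [simp]: "(F \<circ>\<^sub>P G) $ i = subst2 (F $ i) G"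
  by (simp add: comp_pmap_def)

lemma comm_ring_hom_compose:
  assumes "comm_ring_hom f" "comm_ring_hom g"
  shows "comm_ring_hom (\<lambda>x. f (g x))"
proof -
  interpret f: comm_ring_hom f by fact
  interpret g: comm_ring_hom g by fact
  show ?thesis by unfold_locales (simp_all add: f.hom_add g.hom_add f.hom_mult g.hom_mult)
qed

lemma subst2_subst2: "subst2 (subst2 P F) G = subst2 P (F \<circ>\<^sub>P G)"
  by (rule bpoly_hom_unique[OF comm_ring_hom_compose[OF comm_ring_hom_subst2 comm_ring_hom_subst2] comm_ring_hom_subst2])
    simp_all

lemma comm_ring_hom_id: "comm_ring_hom (\<lambda>x :: 'a :: comm_ring_1. x)"
  by unfold_locales simp_all

lemma subst2_id [simp]: "subst2 P id_pmap = P"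
  by (rule bpoly_hom_unique[OF comm_ring_hom_subst2 comm_ring_hom_id]) simp_all

lemma pmap_eqI: "F $ 1 = G $ 1 \<Longrightarrow> F $ 2 = G $ 2 \<Longrightarrow> F = (G :: 'b ^ 2)"
  by (simp add: Finite_Cartesian_Product.vec_eq_iff forall_2)

lemma comp_id_pmap [simp]: "F \<circ>\<^sub>P id_pmap = F" "id_pmap \<circ>\<^sub>P F = F"
  by (rule pmap_eqI; simp)+

lemma comp_pmap_assoc: "(F \<circ>\<^sub>P G) \<circ>\<^sub>P H = F \<circ>\<^sub>P (G \<circ>\<^sub>P H)"
  by (rule pmap_eqI) (simp_all add: subst2_subst2)

lemma X1_X2_monom: "X\<^sub>1 = monom (monom 1 1) 0" "X\<^sub>2 = monom (monom 1 0) 1"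
    "const2 c = monom (monom c 0) 0"
  by (simp_all add: X\<^sub>1_def X\<^sub>2_def const2_def monom_altdef)

lemma X_nonzero [simp]: "X\<^sub>1 \<noteq> 0" "X\<^sub>2 \<noteq> 0"
  by (simp_all add: X\<^sub>1_def X\<^sub>2_def)

section \<open>Weighted degrees and multiplicities\<close>

text \<open>
  The substitution \<open>X\<^sub>1 \<mapsto> X\<^sub>1 t\<^sup>a\<close>, \<open>X\<^sub>2 \<mapsto> X\<^sub>2 t\<^sup>b\<close>: degree and leading coefficient in \<open>t\<close> are the
  weighted degree and the weighted leading form, so \<open>h\<close> is
  homogeneous iff \<open>wtop a b h = h\<close>.
\<close>

definition grade :: "nat \<Rightarrow> nat \<Rightarrow> 'a::field bpoly \<Rightarrow> 'a bpoly poly" where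
  "grade a b = bpoly_eval (\<lambda>c. [:const2 c:]) (monom X\<^sub>1 a) (monom X\<^sub>2 b)"

abbreviation wdeg :: "nat \<Rightarrow> nat \<Rightarrow> 'a::field bpoly \<Rightarrow> nat" where
  "wdeg a b h \<equiv> degree (grade a b h)"

abbreviation wtop :: "nat \<Rightarrow> nat \<Rightarrow> 'a::field bpoly \<Rightarrow> 'a bpoly" where
  "wtop a b h \<equiv> lead_coeff (grade a b h)"

lemma comm_ring_hom_pCons_const2: "comm_ring_hom (\<lambda>c. [:const2 c:])"
  by unfold_locales (simp_all add: const2_add const2_mult)

interpretation grade: comm_ring_hom "grade a b"
  unfolding grade_def by (intro comm_ring_hom_bpoly_eval comm_ring_hom_pCons_const2)

lemma grade_gens [simp]:
  "grade a b (const2 c) = [:const2 c:]" "grade a b X\<^sub>1 = monom X\<^sub>1 a" "grade a b X\<^sub>2 = monom X\<^sub>2 b"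
  by (simp_all add: grade_def bpoly_eval_gens[OF comm_ring_hom_pCons_const2])

lemma grade_monom:
  "grade a b (monom (monom c i) j) = monom (monom (monom c i) j) (a * i + b * j)"
  by (simp add: bpoly_monom_eq grade.hom_mult grade.hom_power monom_power mult_monom smult_monom)

text \<open>Identifies the coefficients in \<open>t\<close> with the weighted homogeneous
  components, which turns degree statements into statements about supports; additivity reduces it to
  monomials.\<close>

lemma bcoeff_coeff_grade:
  "bcoeff (coeff (grade a b h) n) i j = (if a * i + b * j = n then bcoeff h i j else 0)"
proof (induction h rule: bpoly_additive_induct)
  case (1 c i' j')
  then show ?case by (auto simp: grade_monom bcoeff_monom)
next
  case (2 p q)
  then show ?case by (simp add: grade.hom_add)
qed

lemma grade_coeff_grade: "grade a b (coeff (grade a b h) n) = monom (coeff (grade a b h) n) n"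
  by (rule poly_eqI, rule bpoly_eqI) (simp add: bcoeff_coeff_grade)

lemma grade_eq_0_iff [simp]: "grade a b h = 0 \<longleftrightarrow> h = 0"
proof
  assume "grade a b h = 0"
  then have "bcoeff h i j = 0" for i j
    using bcoeff_coeff_grade[of a b h "a * i + b * j" i j] by simp
  then show "h = 0" by (intro bpoly_eqI) simp
qed simp

lemma bcoeff_nonzero_imp_le_wdeg:
  assumes "bcoeff h i j \<noteq> 0"
  shows "a * i + b * j \<le> wdeg a b h"
proof (rule le_degree)
  show "coeff (grade a b h) (a * i + b * j) \<noteq> 0"
    using assms bcoeff_coeff_grade[of a b h "a * i + b * j" i j] by auto
qed

lemma wdeg_le_iff: "wdeg a b h \<le> n \<longleftrightarrow> (\<forall>i j. bcoeff h i j \<noteq> 0 \<longrightarrow> a * i + b * j \<le> n)"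
proof
  assume *: "\<forall>i j. bcoeff h i j \<noteq> 0 \<longrightarrow> a * i + b * j \<le> n"
  have "coeff (grade a b h) m = 0" if "m > n" for m
  proof (rule bpoly_eqI)
    show "bcoeff (coeff (grade a b h) m) i j = bcoeff 0 i j" for i j
      using *[rule_format, of i j] that by (cases "bcoeff h i j = 0") (simp_all add: bcoeff_coeff_grade)
  qed
  then show "wdeg a b h \<le> n" by (intro degree_le) auto
qed (use bcoeff_nonzero_imp_le_wdeg le_trans in blast)

lemma wdeg_attained:
  assumes "h \<noteq> 0"
  obtains i j where "bcoeff h i j \<noteq> 0" "a * i + b * j = wdeg a b h"
proof -
  have "wtop a b h \<noteq> 0" using assms by simp
  then obtain i j where "bcoeff (wtop a b h) i j \<noteq> 0"
    using bpoly_eqI[of "wtop a b h" 0] by auto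
  then show ?thesis using that by (auto simp: bcoeff_coeff_grade split: if_splits)
qed

lemma wdeg_mult: "p \<noteq> 0 \<Longrightarrow> q \<noteq> 0 \<Longrightarrow> wdeg a b (p * q) = wdeg a b p + wdeg a b q"
  by (simp add: grade.hom_mult degree_mult_eq)

lemma wtop_mult: "wtop a b (p * q) = wtop a b p * wtop a b q"
  by (simp only: grade.hom_mult lead_coeff_mult)

lemma wtop_power: "wtop a b (p ^ n) = wtop a b p ^ n"
  by (simp only: grade.hom_power lead_coeff_power)

lemma wdeg_power: "wdeg a b (p ^ n) = n * wdeg a b p"
  by (cases "p = 0") (simp_all add: grade.hom_power degree_power_eq power_0_left)

lemma grade_wtop: "grade a b (wtop a b h) = monom (wtop a b h) (wdeg a b h)"
  by (rule grade_coeff_grade)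

lemma wdeg_wtop [simp]: "wdeg a b (wtop a b h) = wdeg a b h"
  by (cases "h = 0") (simp_all add: grade_wtop degree_monom_eq)

lemma wtop_wtop: "wtop a b (wtop a b h) = wtop a b h"
  by (subst wdeg_wtop) (simp add: grade_wtop)

lemma wdeg_eq_0_imp_const:
  assumes "a > 0" "b > 0" "wdeg a b h = 0"
  obtains c where "h = const2 c"
proof
  show "h = const2 (bcoeff h 0 0)"
  proof (rule bpoly_eqI)
    fix i j
    show "bcoeff h i j = bcoeff (const2 (bcoeff h 0 0)) i j"
      using bcoeff_nonzero_imp_le_wdeg[of h i j a b] assms
      by (cases "bcoeff h i j = 0") (auto simp: X1_X2_monom bcoeff_monom)
  qed
qed

lemma const2_dvd_1: "c \<noteq> 0 \<Longrightarrow> const2 c dvd 1"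
  by (rule dvdI[of _ _ "const2 (inverse c)"]) (simp flip: const2_mult)

section \<open>The rank-two valuation of a homogeneous prime\<close>

definition pmult :: "'a::idom \<Rightarrow> 'a \<Rightarrow> nat" where
  "pmult P h = (GREATEST n. P ^ n dvd h)"

lemma pmult_eqI:
  assumes "h = P ^ n * q" "\<not> P dvd q" "P \<noteq> 0"
  shows "pmult P h = n"
  unfolding pmult_def
proof (rule Greatest_equality)
  show "P ^ n dvd h" using assms by simp
  show "m \<le> n" if "P ^ m dvd h" for m
  proof (rule ccontr)
    assume "\<not> m \<le> n"
    then have "P ^ n * P dvd P ^ m" by (metis le_imp_power_dvd not_less_eq_eq power_Suc2)
    with that assms have "P ^ n * P dvd P ^ n * q" by (metis dvd_trans)
    with assms show False by simp
  qed
qed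

locale graded_prime =
  fixes a b :: nat and P :: "'a::field bpoly"
  assumes a_pos: "a > 0" and b_pos: "b > 0"
    and prime: "prime_elem P" and wtop_P: "wtop a b P = P" and wdeg_P: "wdeg a b P > 0"
begin

abbreviation D where "D h \<equiv> wdeg a b h"

definition e :: "'a bpoly \<Rightarrow> nat" where "e h = pmult P (wtop a b h)"

lemma P_nonzero [simp]: "P \<noteq> 0" using prime by auto

text \<open>\<open>GREATEST\<close> is meaningful only for bounded exponents: each factor
  \<open>P\<close> adds at least one to the weighted degree, so no exponent exceeds
  \<open>D h\<close>.\<close>

lemma pmult_decomp:
  assumes "h \<noteq> 0"
  obtains q where "h = P ^ pmult P h * q" "\<not> P dvd q"
proof -
  have bound: "n \<le> D h" if "P ^ n dvd h" for n
  proof -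
    from that obtain q where q: "h = P ^ n * q" by (auto elim: dvdE)
    then have "D h = n * D P + D q" using assms by (simp add: wdeg_mult wdeg_power)
    then show ?thesis using wdeg_P by (metis One_nat_def Suc_leI le_add1 le_trans mult.right_neutral mult_le_mono2)
  qed
  have "\<exists>n. P ^ n dvd h \<and> \<not> P ^ Suc n dvd h"
  proof (rule ccontr)
    assume *: "\<not> ?thesis"
    have "P ^ n dvd h" for n by (induction n) (simp, use * in blast)
    from bound[OF this] show False by (metis Suc_n_not_le_n)
  qed
  then obtain n where n: "P ^ n dvd h" "\<not> P ^ Suc n dvd h" by blast
  then obtain q where q: "h = P ^ n * q" by (auto elim: dvdE)
  have "\<not> P dvd q" using n(2) q by (auto simp: power_Suc2 simp del: power_Suc)
  with q show ?thesis using that pmult_eqI[of h P n q] by simp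
qed

lemma e_decomp:
  assumes "h \<noteq> 0"
  obtains q where "wtop a b h = P ^ e h * q" "\<not> P dvd q"
  using pmult_decomp[of "wtop a b h"] assms unfolding e_def by (metis leading_coeff_0_iff grade_eq_0_iff)

lemma e_eqI: "wtop a b h = P ^ n * q \<Longrightarrow> \<not> P dvd q \<Longrightarrow> e h = n"
  by (simp add: e_def pmult_eqI)

text \<open>Primality keeps the product of the two cofactors indivisible by
  \<open>P\<close>.\<close>

lemma e_mult:
  assumes "h \<noteq> 0" "h' \<noteq> 0"
  shows "e (h * h') = e h + e h'"
proof -
  obtain q where q: "wtop a b h = P ^ e h * q" "\<not> P dvd q" using e_decomp assms by blast
  obtain q' where q': "wtop a b h' = P ^ e h' * q'" "\<not> P dvd q'" using e_decomp assms by blast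
  show ?thesis
  proof (rule e_eqI)
    show "wtop a b (h * h') = P ^ (e h + e h') * (q * q')"
      by (simp only: wtop_mult q(1) q'(1) power_add mult_ac)
    show "\<not> P dvd q * q'" using q q' prime by (simp add: prime_elem_dvd_mult_iff)
  qed
qed

lemma e_dvd_iff: "h \<noteq> 0 \<Longrightarrow> P ^ n dvd wtop a b h \<longleftrightarrow> n \<le> e h"
proof -
  assume "h \<noteq> 0"
  then obtain q where q: "wtop a b h = P ^ e h * q" "\<not> P dvd q" using e_decomp by blast
  show ?thesis
  proof
    assume *: "P ^ n dvd wtop a b h"
    show "n \<le> e h"
    proof (rule ccontr)
      assume "\<not> n \<le> e h"
      then have "P ^ e h * P dvd P ^ n" by (metis le_imp_power_dvd not_less_eq_eq power_Suc2)
      with * q have "P ^ e h * P dvd P ^ e h * q" by (metis dvd_trans)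
      with q show False by simp
    qed
  qed (auto simp: q(1) intro: dvd_mult2 le_imp_power_dvd)
qed

lemma e_const2: "c \<noteq> 0 \<Longrightarrow> e (const2 c) = 0"
  by (rule e_eqI[where q = "const2 c"])
     (use prime const2_dvd_1[of c] in \<open>auto dest: dvd_trans simp: prime_elem_def\<close>)

lemma e_power: "h \<noteq> 0 \<Longrightarrow> e (h ^ n) = n * e h"
proof (induction n)
  case 0
  then show ?case using e_const2[of 1] by simp
qed (simp add: e_mult)

text \<open>
  \<open>low d m h\<close> says that the value of \<open>h\<close> is below \<open>(d, m)\<close>, where a larger multiplicity of \<open>P\<close>
  makes a value smaller. In this form it is visibly closed under addition.
\<close>

definition low :: "nat \<Rightarrow> nat \<Rightarrow> 'a bpoly \<Rightarrow> bool" where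
  "low d m h \<longleftrightarrow> D h \<le> d \<and> P ^ Suc m dvd coeff (grade a b h) d"

lemma low_0 [simp]: "low d m 0" by (simp add: low_def)

lemma low_add: "low d m h \<Longrightarrow> low d m h' \<Longrightarrow> low d m (h + h')"
  unfolding low_def by (simp only: grade.hom_add coeff_add) (auto intro: degree_add_le dvd_add)

lemma low_uminus: "low d m h \<Longrightarrow> low d m (- h)"
  unfolding low_def by (simp add: grade.hom_uminus)

text \<open>For \<open>D h < d\<close> the coefficient at \<open>d\<close> is 0, which every power
  of \<open>P\<close> divides, so the divisibility in \<open>low\<close> only matters for
  \<open>D h = d\<close>.\<close>

lemma low_iff: "h \<noteq> 0 \<Longrightarrow> low d m h \<longleftrightarrow> D h < d \<or> D h = d \<and> m < e h"
  using e_dvd_iff[of h "Suc m"] by (auto simp: low_def coeff_eq_0)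

lemma low_trans: "low d m h \<Longrightarrow> h \<noteq> 0 \<Longrightarrow> low (D h) (e h) h' \<Longrightarrow> low d m h'"
  by (cases "h' = 0") (auto simp: low_iff)

lemma low_mult: "low d m h \<Longrightarrow> r \<noteq> 0 \<Longrightarrow> low (d + D r) (m + e r) (h * r)"
  by (cases "h = 0") (auto simp: low_iff wdeg_mult e_mult)

text \<open>Values are totally ordered, so it suffices to exclude both strict inequalities: either
  would make \<open>q\<close> or \<open>h\<close> a sum of elements below itself.\<close>

lemma low_diffD:
  assumes "low (D q) (e q) (h - q)" "q \<noteq> 0"
  shows "h \<noteq> 0" "D h = D q" "e h = e q"
proof -
  show h: "h \<noteq> 0"
  proof
    assume "h = 0"
    with assms have "low (D q) (e q) (- (0 - q))" by (intro low_uminus) simp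
    then show False using assms(2) by (simp add: low_iff)
  qed
  have lt: "\<not> low (D q) (e q) h"
  proof
    assume "low (D q) (e q) h"
    then have "low (D q) (e q) (h + - (h - q))" using assms by (intro low_add low_uminus)
    then show False using assms(2) by (simp add: low_iff)
  qed
  moreover have "\<not> low (D h) (e h) q"
  proof
    assume q: "low (D h) (e h) q"
    have "low (D h) (e h) ((h - q) + q)" using low_trans[OF q assms(2,1)] q by (rule low_add)
    then show False using h by (simp add: low_iff)
  qed
  ultimately show "D h = D q" "e h = e q"
    using h assms(2) by (auto simp: low_iff)
qed

end

section \<open>Expansion along a minimal unbalanced element\<close>

lemma bcoeff_mult_low:
  fixes p q :: "'a::comm_semiring_0 poly poly"
  shows "bcoeff (p * q) 0 0 = bcoeff p 0 0 * bcoeff q 0 0"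
    and "bcoeff (p * q) (Suc 0) 0 = bcoeff p (Suc 0) 0 * bcoeff q 0 0 + bcoeff p 0 0 * bcoeff q (Suc 0) 0"
    and "bcoeff (p * q) 0 (Suc 0) = bcoeff p 0 (Suc 0) * bcoeff q 0 0 + bcoeff p 0 0 * bcoeff q 0 (Suc 0)"
  by (simp_all add: bcoeff_def coeff_mult add.commute)

text \<open>The power rule modulo the square of the ideal of the origin; the truncated
  \<open>n - 1\<close> at \<open>n = 0\<close> is harmless because \<open>of_nat n\<close> is then
  0.\<close>

lemma bcoeff_power_low:
  fixes p :: "'a::comm_ring_1 poly poly"
  shows "bcoeff (p ^ n) (Suc 0) 0 = of_nat n * bcoeff p 0 0 ^ (n - 1) * bcoeff p (Suc 0) 0"
    and "bcoeff (p ^ n) 0 (Suc 0) = of_nat n * bcoeff p 0 0 ^ (n - 1) * bcoeff p 0 (Suc 0)"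
proof -
  have 0: "bcoeff (p ^ n) 0 0 = bcoeff p 0 0 ^ n" for n
    by (induction n) (simp_all add: bcoeff_mult_low, simp add: bcoeff_def)
  have "bcoeff (p ^ n) (Suc 0) 0 = of_nat n * bcoeff p 0 0 ^ (n - 1) * bcoeff p (Suc 0) 0 \<and>
    bcoeff (p ^ n) 0 (Suc 0) = of_nat n * bcoeff p 0 0 ^ (n - 1) * bcoeff p 0 (Suc 0)"
  proof (induction n)
    case 0
    then show ?case by (simp add: bcoeff_def)
  next
    case (Suc n)
    then show ?case
      by (cases n) (simp_all add: bcoeff_mult_low 0 algebra_simps)
  qed
  then show "bcoeff (p ^ n) (Suc 0) 0 = of_nat n * bcoeff p 0 0 ^ (n - 1) * bcoeff p (Suc 0) 0"
    and "bcoeff (p ^ n) 0 (Suc 0) = of_nat n * bcoeff p 0 0 ^ (n - 1) * bcoeff p 0 (Suc 0)"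
    by simp_all
qed

lemma bcoeff_const2_mult [simp]: "bcoeff (const2 c * p) i j = c * bcoeff p i j"
  by (simp add: bcoeff_def const2_def)

lemma subst2_inject:
  assumes "F \<circ>\<^sub>P G = id_pmap" "subst2 p F = subst2 q F"
  shows "p = q"
  using arg_cong[OF assms(2), of "\<lambda>h. subst2 h G"] by (simp add: subst2_subst2 assms(1))

context graded_prime
begin

text \<open>For \<open>N\<close> and \<open>k\<close> the degree and the multiplicity of \<open>f\<close>: the value of \<open>h\<close> is proportional to that of \<open>f\<close>.\<close>

definition balanced :: "nat \<Rightarrow> nat \<Rightarrow> 'a bpoly \<Rightarrow> bool" where
  "balanced N k h \<longleftrightarrow> N * e h = k * D h"

lemma balanced_mult_iff:
  "x \<noteq> 0 \<Longrightarrow> y \<noteq> 0 \<Longrightarrow> balanced N k x \<Longrightarrow> balanced N k (x * y) \<longleftrightarrow> balanced N k y"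
  by (simp add: balanced_def e_mult wdeg_mult algebra_simps)

lemma balanced_power_iff: "x \<noteq> 0 \<Longrightarrow> balanced N k (x ^ Suc n) \<longleftrightarrow> balanced N k x"
proof -
  assume x: "x \<noteq> 0"
  have "balanced N k (x ^ Suc n) \<longleftrightarrow> Suc n * (N * e x) = Suc n * (k * D x)"
    by (simp only: balanced_def e_power[OF x] wdeg_power ac_simps)
  then show ?thesis unfolding balanced_def mult_cancel1 by simp
qed

text \<open>No two terms have the same value, because \<open>\<phi>\<close> is not balanced while the coefficients are.\<close>

lemma dominating_term:
  assumes "A \<noteq> 0" "\<And>i. coeff A i = 0 \<or> balanced N k (coeff A i)"
    and \<phi>: "\<phi> \<noteq> 0" "\<not> balanced N k \<phi>"
  shows "\<exists>i. coeff A i \<noteq> 0 \<and> low (D (coeff A i * \<phi> ^ i)) (e (coeff A i * \<phi> ^ i)) (poly A \<phi> - coeff A i * \<phi> ^ i)"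
  using assms(1,2)
proof (induction A rule: pCons_induct)
  case (pCons a A)
  show ?case
  proof (cases "A = 0")
    case True
    then show ?thesis using pCons by (intro exI[of _ 0]) simp
  next
    case False
    have "coeff A i = 0 \<or> balanced N k (coeff A i)" for i
      using pCons.prems(2)[of "Suc i"] by simp
    with pCons.IH[OF False] obtain i where i: "coeff A i \<noteq> 0"
      "low (D (coeff A i * \<phi> ^ i)) (e (coeff A i * \<phi> ^ i)) (poly A \<phi> - coeff A i * \<phi> ^ i)"
      by blast
    define t where "t = coeff A i * \<phi> ^ i"
    have t: "t \<noteq> 0" "t * \<phi> \<noteq> 0" using i \<phi> by (simp_all add: t_def)
    have low1: "low (D (t * \<phi>)) (e (t * \<phi>)) ((poly A \<phi> - t) * \<phi>)"
      using low_mult[OF i(2) \<phi>(1)] t \<phi> by (simp add: wdeg_mult e_mult flip: t_def)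
    have coeff_Suc: "coeff (pCons a A) (Suc i) * \<phi> ^ Suc i = t * \<phi>" by (simp add: t_def)
    have eq: "poly (pCons a A) \<phi> = a + ((poly A \<phi> - t) * \<phi> + t * \<phi>)" by (simp add: algebra_simps)
    show ?thesis
    proof (cases "low (D (t * \<phi>)) (e (t * \<phi>)) a")
      case True
      then have "low (D (t * \<phi>)) (e (t * \<phi>)) (a + (poly A \<phi> - t) * \<phi>)"
        using low1 by (intro low_add)
      then show ?thesis using i(1)
        by (intro exI[of _ "Suc i"], unfold coeff_Suc eq) (simp add: algebra_simps)
    next
      case False
      then have a: "a \<noteq> 0" by auto
      have "balanced N k a" using pCons.prems(2)[of 0] a by simp
      \<comment> \<open>The term \<open>t * \<phi>\<close> contains at least one factor
        \<open>\<phi>\<close>, so it cannot tie with the balanced \<open>a\<close>; the larger of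
        the two dominates.\<close>
      moreover have "\<not> balanced N k (t * \<phi>)"
        using balanced_mult_iff[of "coeff A i" "\<phi> ^ Suc i" N k] balanced_power_iff[of \<phi> N k i] i(1) \<phi>
          pCons.prems(2)[of "Suc i"] by (simp add: t_def mult_ac)
      ultimately have "\<not> (D a = D (t * \<phi>) \<and> e a = e (t * \<phi>))" by (auto simp: balanced_def)
      with False have "low (D a) (e a) (t * \<phi>)" using a t by (auto simp: low_iff)
      then have "low (D a) (e a) ((poly A \<phi> - t) * \<phi> + t * \<phi>)"
        using low_trans[OF _ t(2) low1] by (intro low_add)
      then show ?thesis using a
        by (intro exI[of _ 0], unfold eq) simp
    qed
  qed
qed simp

text \<open>\<open>[:c:]\<close> involves only \<open>X\<^sub>1\<close>, so this concerns the
  elements of \<open>K[f]\<close>: \<open>f\<close> has positive degree, so its powers have distinct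
  degrees and the highest dominates. Nonzero elements of \<open>K[f]\<close> are therefore
  balanced.\<close>

lemma first_component_powers:
  fixes c :: "'a poly"
  assumes "c \<noteq> 0" "D (F $ 1) > 0"
  shows "subst2 [:c:] F \<noteq> 0 \<and> D (subst2 [:c:] F) = degree c * D (F $ 1) \<and>
    e (subst2 [:c:] F) = degree c * e (F $ 1)"
  using assms(1)
proof (induction c rule: pCons_induct)
  case (pCons c0 c)
  have eq: "[:pCons c0 c:] = const2 c0 + X\<^sub>1 * [:c:]" by (simp add: const2_def X\<^sub>1_def)
  have f: "F $ 1 \<noteq> 0" using assms(2) by auto
  show ?case
  proof (cases "c = 0")
    case True
    then show ?thesis using pCons
      by (simp add: const2_def[symmetric] e_const2)
  next
    case False
    define q where "q = F $ 1 * subst2 [:c:] F"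
    have q: "q \<noteq> 0" "D q = Suc (degree c) * D (F $ 1)" "e q = Suc (degree c) * e (F $ 1)"
      using pCons.IH[OF False] f by (simp_all add: q_def wdeg_mult e_mult)
    have "low (D q) (e q) (const2 c0)"
      using q(2) assms(2) by (cases "c0 = 0") (simp_all add: low_iff)
    moreover have "subst2 [:pCons c0 c:] F = const2 c0 + q"
      by (simp only: eq subst2.hom_add subst2.hom_mult subst2_gens q_def)
    ultimately show ?thesis using low_diffD[of q "const2 c0 + q"] q False by simp
  qed
qed simp

text \<open>Repeated pseudo-division by \<open>p\<close> in \<open>K[X\<^sub>1][X\<^sub>2]\<close>:
  the digits have smaller degree than \<open>p\<close>, hence become balanced or 0 under
  \<open>F\<close>, and \<open>c\<close> collects powers of the leading coefficient of
  \<open>p\<close>.\<close>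

lemma expansion:
  assumes p: "degree p > 0" "\<And>q. q \<noteq> 0 \<Longrightarrow> degree q < degree p \<Longrightarrow> balanced N k (subst2 q F)"
  shows "\<exists>(c :: 'a poly) A. c \<noteq> 0 \<and> (\<forall>i. coeff A i = 0 \<or> balanced N k (coeff A i)) \<and>
    subst2 [:c:] F * subst2 q F = poly A (subst2 p F)"
proof (induction "degree q" arbitrary: q rule: less_induct)
  case less
  have bal0: "subst2 q F = 0 \<or> balanced N k (subst2 q F)" if "degree q < degree p" for q
    using p(2)[of q] that by (cases "q = 0") auto
  show ?case
  proof (cases "degree q < degree p")
    case True
    then show ?thesis using bal0[of q]
      by (intro exI[of _ 1] exI[of _ "[:subst2 q F:]"]) (auto simp: coeff_pCons split: nat.split)
  next
    case False
    obtain s r where sr: "pseudo_divmod q p = (s, r)" by (cases "pseudo_divmod q p")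
    have p0: "p \<noteq> 0" using p by auto
    define c where "c = lead_coeff p ^ (Suc (degree q) - degree p)"
    have c0: "c \<noteq> 0" using p0 by (simp add: c_def)
    have div: "smult c q = p * s + r" "r = 0 \<or> degree r < degree p"
      using pseudo_divmod[OF p0 sr] by (simp_all add: c_def)
    have r: "degree r < degree p" using div(2) p by auto
    have "degree s < degree q"
    proof (cases "s = 0")
      case True
      then show ?thesis using False p by simp
    next
      case s: False
      have "degree (p * s) = degree p + degree s" using s p0 by (simp add: degree_mult_eq)
      then have "degree (p * s + r) = degree p + degree s" using r by (simp add: degree_add_eq_left)
      then show ?thesis using div(1) c0 p by (metis degree_smult_eq less_add_same_cancel2)
    qed
    from less.hyps[OF this] obtain c' :: "'a poly" and A where c': "c' \<noteq> 0"
      and A: "\<forall>i. coeff A i = 0 \<or> balanced N k (coeff A i)"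
      and eq: "subst2 [:c':] F * subst2 s F = poly A (subst2 p F)" by blast
    \<comment> \<open>The factor \<open>c'\<close> from the expansion of the quotient also
      multiplies the remainder; the degree in \<open>X\<^sub>2\<close> stays below
      \<open>degree p\<close>, so the product serves as new constant digit.\<close>
    have "[:c' * c:] * q = [:c':] * (p * s + r)" by (simp flip: div(1) add: mult.commute)
    then have "subst2 ([:c' * c:] * q) F = subst2 ([:c':] * (p * s + r)) F" by simp
    then have "subst2 [:c' * c:] F * subst2 q F =
      subst2 p F * (subst2 [:c':] F * subst2 s F) + subst2 ([:c':] * r) F"
      by (simp only: subst2.hom_mult subst2.hom_add ring_distribs mult_ac)
    also have "\<dots> = poly (pCons (subst2 ([:c':] * r) F) A) (subst2 p F)" by (simp add: eq)
    finally have "subst2 [:c' * c:] F * subst2 q F = \<dots>" .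
    moreover have "\<forall>i. coeff (pCons (subst2 ([:c':] * r) F) A) i = 0 \<or>
      balanced N k (coeff (pCons (subst2 ([:c':] * r) F) A) i)"
      using A bal0[of "[:c':] * r"] r by (auto simp: coeff_pCons c' split: nat.split)
    ultimately show ?thesis using c' c0 by (metis mult_eq_0_iff)
  qed
qed

text \<open>Substituting \<open>G\<close> rewrites each \<open>h\<close> as a polynomial in the
  components of \<open>F\<close>. Taking \<open>\<phi>\<close> unbalanced of least degree in the
  second component makes all digits of an expansion along \<open>\<phi>\<close> balanced, so one
  term dominates.\<close>

lemma key_element:
  assumes FG: "F \<circ>\<^sub>P G = id_pmap" "G \<circ>\<^sub>P F = id_pmap" and f: "D (F $ 1) > 0"
    and N: "N = D (F $ 1)" and k: "k = e (F $ 1)"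
    and ex: "h0 \<noteq> 0" "\<not> balanced N k h0"
  shows "\<exists>\<phi>. \<phi> \<noteq> 0 \<and> \<not> balanced N k \<phi> \<and>
    (\<forall>h. h \<noteq> 0 \<longrightarrow> (\<exists>c a i. c \<noteq> 0 \<and> a \<noteq> 0 \<and> balanced N k c \<and> balanced N k a \<and>
      low (D (a * \<phi> ^ i)) (e (a * \<phi> ^ i)) (c * h - a * \<phi> ^ i)))"
proof -
  have surj: "subst2 (subst2 h G) F = h" for h by (simp add: subst2_subst2 FG)
  have inj: "subst2 q F \<noteq> 0" if "q \<noteq> 0" for q
    using subst2_inject[OF FG(1), of q 0] that by auto
  have bal: "balanced N k (subst2 [:c:] F)" if "c \<noteq> 0" for c :: "'a poly"
    using first_component_powers[OF that f] by (simp add: balanced_def N k)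
  define Q where "Q p \<longleftrightarrow> p \<noteq> 0 \<and> \<not> balanced N k (subst2 p F)" for p
  have "Q (subst2 h0 G)" using ex surj[of h0] by (auto simp: Q_def)
  then obtain p where p: "Q p" "\<And>q. Q q \<Longrightarrow> degree p \<le> degree q"
    using ex_has_least_nat[of Q _ degree] by blast
  \<comment> \<open>Degree 0 would place \<open>\<phi>\<close> in \<open>K[f]\<close>, whose nonzero
    elements are balanced.\<close>
  have "degree p > 0"
  proof (rule ccontr)
    assume "\<not> degree p > 0"
    then obtain c where "p = [:c:]" by (auto elim: degree_eq_zeroE)
    then show False using p(1) bal[of c] by (auto simp: Q_def)
  qed
  note expansion = expansion[where F = F, OF this, of N k]
  have phi: "subst2 p F \<noteq> 0" "\<not> balanced N k (subst2 p F)" using p(1) inj by (auto simp: Q_def)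
  have "\<exists>c a i. c \<noteq> 0 \<and> a \<noteq> 0 \<and> balanced N k c \<and> balanced N k a \<and>
      low (D (a * subst2 p F ^ i)) (e (a * subst2 p F ^ i)) (c * h - a * subst2 p F ^ i)"
    if h: "h \<noteq> 0" for h
  proof -
    obtain c A where cA: "c \<noteq> 0" "\<And>i. coeff A i = 0 \<or> balanced N k (coeff A i)"
      "subst2 [:c:] F * h = poly A (subst2 p F)"
      using expansion[of "subst2 h G"] p(2) unfolding surj Q_def by (metis not_less)
    have "subst2 [:c:] F \<noteq> 0" using cA(1) by (intro inj) simp
    moreover from this have "A \<noteq> 0" using h cA(3) by auto
    ultimately show ?thesis
      using dominating_term[OF _ cA(2) phi] bal[OF cA(1)] cA(2,3) by metis
  qed
  with phi show ?thesis by blast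
qed

end

section \<open>Leading forms of coordinates\<close>

context graded_prime
begin

lemma e_P: "e P = 1"
  using prime by (intro e_eqI[where q = 1]) (auto simp: wtop_P prime_elem_def)

text \<open>A value on the line of \<open>P\<close> leaves a cofactor of weighted degree 0, which is
  constant since both weights are positive.\<close>

lemma balanced_imp_top:
  assumes "h \<noteq> 0" "D P * e h = D h"
  obtains c where "c \<noteq> 0" "wtop a b h = const2 c * P ^ e h"
proof -
  obtain q where q: "wtop a b h = P ^ e h * q" "\<not> P dvd q" using e_decomp assms by blast
  have "q \<noteq> 0" using q by auto
  have "D h = e h * D P + D q"
    using arg_cong[OF q(1), of D] \<open>q \<noteq> 0\<close> by (simp add: wdeg_mult wdeg_power del: wdeg_wtop) (simp add: wdeg_wtop)
  then have "D q = 0" using assms(2) by (simp add: mult.commute)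
  then obtain c where "q = const2 c" using wdeg_eq_0_imp_const a_pos b_pos by blast
  then show ?thesis using that[of c] q \<open>q \<noteq> 0\<close> by (simp add: mult.commute)
qed

text \<open>A nonconstant cofactor \<open>Q\<close> would put \<open>P\<close> and \<open>Q\<close>
  strictly on opposite sides of the line through the value of \<open>f\<close>, whereas the
  dominating terms place all values on one side.\<close>

lemma top_eq_const_prime_power:
  assumes FG: "F \<circ>\<^sub>P G = id_pmap" "G \<circ>\<^sub>P F = id_pmap" and k: "e (F $ 1) > 0" and f: "D (F $ 1) > 0"
  shows "D (F $ 1) = e (F $ 1) * D P"
proof -
  define N where "N = D (F $ 1)"
  define k where "k = e (F $ 1)"
  have f0: "F $ 1 \<noteq> 0" using f by auto
  obtain Q where Q: "wtop a b (F $ 1) = P ^ k * Q" "\<not> P dvd Q"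
    using e_decomp[OF f0] unfolding k_def by blast
  have Q0: "Q \<noteq> 0" using Q by auto
  have "wtop a b (P ^ k * Q) = P ^ k * Q"
    using wtop_wtop[of a b "F $ 1"] by (simp only: Q(1))
  then have topQ: "wtop a b Q = Q" by (simp only: wtop_mult wtop_power wtop_P) simp
  have eQ: "e Q = 0" using Q by (intro e_eqI[where q = Q]) (simp_all add: topQ)
  have N: "N = k * D P + D Q"
    using wdeg_wtop[of a b "F $ 1"] wdeg_mult[of "P ^ k" Q a b] Q0 unfolding N_def Q(1) by (simp add: wdeg_power)
  have "D Q = 0"
  proof (rule ccontr)
    assume DQ: "D Q \<noteq> 0"
    have unbal: "\<not> balanced N k Q" using DQ k by (simp add: balanced_def eQ k_def)
    obtain \<phi> where \<phi>: "\<phi> \<noteq> 0" "\<not> balanced N k \<phi>"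
      "\<forall>h. h \<noteq> 0 \<longrightarrow> (\<exists>c a i. c \<noteq> 0 \<and> a \<noteq> 0 \<and> balanced N k c \<and> balanced N k a \<and>
        low (D (a * \<phi> ^ i)) (e (a * \<phi> ^ i)) (c * h - a * \<phi> ^ i))"
      using key_element[OF FG f N_def k_def Q0 unbal] by blast
    \<comment> \<open>\<open>l\<close> takes values of one sign only, but \<open>l P = deg Q\<close> and \<open>l Q = - k deg Q\<close>.\<close>
    define l where "l h = int N * int (e h) - int k * int (D h)" for h
    have l_mult: "l (x * y) = l x + l y" if "x \<noteq> 0" "y \<noteq> 0" for x y
      using that by (simp add: l_def e_mult wdeg_mult algebra_simps)
    have l_power: "l (\<phi> ^ i) = int i * l \<phi>" for i
      using \<phi>(1) by (simp add: l_def e_power wdeg_power algebra_simps)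
    have l_bal: "l x = 0" if "balanced N k x" for x
      using that by (simp add: l_def balanced_def flip: of_nat_mult)
    have l_multiple: "\<exists>i::nat. l h = int i * l \<phi>" if h: "h \<noteq> 0" for h
    proof -
      obtain c x i where *: "c \<noteq> 0" "x \<noteq> 0" "balanced N k c" "balanced N k x"
        "low (D (x * \<phi> ^ i)) (e (x * \<phi> ^ i)) (c * h - x * \<phi> ^ i)" using \<phi>(3)[rule_format, OF h] by blast
      have "x * \<phi> ^ i \<noteq> 0" using * \<phi>(1) by simp
      from low_diffD[OF *(5) this] have "l (c * h) = l (x * \<phi> ^ i)" by (simp add: l_def)
      \<comment> \<open>\<open>c\<close> and \<open>x\<close> are balanced, so \<open>l\<close> sees
        only the power of \<open>\<phi>\<close>.\<close>
      then have "l h = int i * l \<phi>" using * \<phi>(1) h by (simp add: l_mult l_power l_bal)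
      then show ?thesis ..
    qed
    obtain i j :: nat where ij: "l P = int i * l \<phi>" "l Q = int j * l \<phi>" using l_multiple P_nonzero Q0 by blast
    have "l P = int (D Q)" by (simp add: l_def e_P N)
    moreover have "l Q = - int (k * D Q)" by (simp add: l_def eQ)
    ultimately have "int i * l \<phi> > 0" "int j * l \<phi> < 0" using ij DQ k by (simp_all add: k_def)
    then show False by (simp add: zero_less_mult_iff mult_less_0_iff)
  qed
  then show ?thesis using N by (simp add: N_def k_def)
qed

text \<open>Without a linear part in \<open>P\<close>, congruence modulo \<open>P\<close> preserves
  linear parts. Nonzero multiples of \<open>X\<^sub>1\<close> and \<open>X\<^sub>2\<close> would
  then share their linear parts with multiples of powers of a single \<open>H\<close>, and those are
  all proportional to the linear part of \<open>H\<close>.\<close>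

lemma linear_part_prime:
  assumes FG: "F \<circ>\<^sub>P G = id_pmap" "G \<circ>\<^sub>P F = id_pmap" and k: "e (F $ 1) > 0" and f: "D (F $ 1) > 0"
  shows "bcoeff P (Suc 0) 0 \<noteq> 0 \<or> bcoeff P 0 (Suc 0) \<noteq> 0"
proof (rule ccontr)
  assume "\<not> ?thesis"
  then have P_lin: "bcoeff P (Suc 0) 0 = 0" "bcoeff P 0 (Suc 0) = 0" by simp_all
  have P_00: "bcoeff P 0 0 = 0"
    using bcoeff_coeff_grade[of a b P "D P" 0 0] wdeg_P by (simp only: wtop_P) simp
  have dvd_lin: "bcoeff h (Suc 0) 0 = 0" "bcoeff h 0 (Suc 0) = 0" if "P dvd h" for h
    using that by (auto elim!: dvdE simp: bcoeff_mult_low P_lin P_00)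
  define N where "N = D (F $ 1)"
  define k where "k = e (F $ 1)"
  \<comment> \<open>As \<open>N = k * D P\<close>, the line of \<open>f\<close> is that of
    \<open>P\<close>, so nonzero balanced elements have a constant times a power of \<open>P\<close>
    as leading form.\<close>
  have balanced_iff: "balanced N k h \<longleftrightarrow> D P * e h = D h" for h
    using k top_eq_const_prime_power[OF assms] by (auto simp: balanced_def N_def k_def mult.assoc)
  have X: "bcoeff X\<^sub>1 (Suc 0) 0 = (1 :: 'a)" "bcoeff X\<^sub>1 0 (Suc 0) = (0 :: 'a)"
    "bcoeff X\<^sub>2 (Suc 0) 0 = (0 :: 'a)" "bcoeff X\<^sub>2 0 (Suc 0) = (1 :: 'a)"
    by (simp_all add: X1_X2_monom bcoeff_monom del: monom_eq_1)
  have X_top: "wtop a b X\<^sub>1 = (X\<^sub>1 :: 'a bpoly)" "wtop a b X\<^sub>2 = (X\<^sub>2 :: 'a bpoly)"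
    by (simp_all add: degree_monom_eq)
  have not_dvd: "\<not> P dvd X\<^sub>1" "\<not> P dvd X\<^sub>2" using dvd_lin X by fastforce+
  have eX: "e X\<^sub>1 = 0" "e X\<^sub>2 = 0"
    using not_dvd by (auto intro!: e_eqI[where n = 0] simp: X_top simp del: grade_gens)
  have unbal: "\<not> balanced N k X\<^sub>1"
    using a_pos by (simp add: balanced_iff eX degree_monom_eq)
  obtain \<phi> where \<phi>: "\<phi> \<noteq> 0" "\<not> balanced N k \<phi>"
    "\<forall>h. h \<noteq> 0 \<longrightarrow> (\<exists>c a i. c \<noteq> 0 \<and> a \<noteq> 0 \<and> balanced N k c \<and> balanced N k a \<and>
      low (D (a * \<phi> ^ i)) (e (a * \<phi> ^ i)) (c * h - a * \<phi> ^ i))"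
    using key_element[OF FG f N_def k_def X_nonzero(1) unbal] by blast
  obtain H where H: "wtop a b \<phi> = P ^ e \<phi> * H" "\<not> P dvd H" using e_decomp \<phi>(1) by blast
  have cong: "\<exists>c x i. c \<noteq> 0 \<and> x \<noteq> 0 \<and> P dvd const2 c * h - const2 x * H ^ i"
    if h: "wtop a b h = h" "e h = 0" "h \<noteq> 0" for h
  proof -
    obtain c x i where *: "c \<noteq> 0" "x \<noteq> 0" "balanced N k c" "balanced N k x"
      and low: "low (D (x * \<phi> ^ i)) (e (x * \<phi> ^ i)) (c * h - x * \<phi> ^ i)" using \<phi>(3)[rule_format, OF h(3)] by blast
    obtain c0 where c0: "c0 \<noteq> 0" "wtop a b c = const2 c0 * P ^ e c"
      by (rule balanced_imp_top[of c]) (use *(1,3) balanced_iff in auto)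
    obtain x0 where x0: "x0 \<noteq> 0" "wtop a b x = const2 x0 * P ^ e x"
      by (rule balanced_imp_top[of x]) (use *(2,4) balanced_iff in auto)
    have "x * \<phi> ^ i \<noteq> 0" using * \<phi>(1) by simp
    from low_diffD[OF low this] have eq: "D (c * h) = D (x * \<phi> ^ i)" "e (c * h) = e (x * \<phi> ^ i)" by simp_all
    have e: "e c = e x + i * e \<phi>" using eq(2) * \<phi>(1) h by (simp add: e_mult e_power)
    \<comment> \<open>Both leading forms contain exactly \<open>P ^ e c\<close>, while their
      difference is divisible by one more \<open>P\<close>; cancelling leaves a congruence modulo
      \<open>P\<close>.\<close>
    have "P ^ Suc (e c) dvd wtop a b (c * h) - wtop a b (x * \<phi> ^ i)"
      using low eq h * by (simp add: low_def grade.hom_minus e_mult)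
    also have "wtop a b (c * h) - wtop a b (x * \<phi> ^ i) = P ^ e c * (const2 c0 * h - const2 x0 * H ^ i)"
      unfolding wtop_mult wtop_power c0 x0 H(1) h(1) e
      by (simp add: power_add power_mult_distrib power_mult[symmetric] algebra_simps)
    finally have "P dvd const2 c0 * h - const2 x0 * H ^ i" by (simp add: power_Suc2 del: power_Suc)
    then show ?thesis using c0 x0 by blast
  qed
  obtain c x i where 1: "c \<noteq> 0" "x \<noteq> 0" "P dvd const2 c * X\<^sub>1 - const2 x * H ^ i"
    using cong[OF X_top(1) eX(1) X_nonzero(1)] by blast
  obtain c' x' i' where 2: "c' \<noteq> 0" "x' \<noteq> 0" "P dvd const2 c' * X\<^sub>2 - const2 x' * H ^ i'"
    using cong[OF X_top(2) eX(2) X_nonzero(2)] by blast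
  \<comment> \<open>The \<open>X\<^sub>1\<close>-coefficient forces
    \<open>of_nat i * bcoeff H 0 0 ^ (i - 1)\<close> to be nonzero, so the
    \<open>X\<^sub>2\<close>-coefficient of \<open>H\<close> vanishes; then no multiple of a power
    of \<open>H\<close> can match \<open>X\<^sub>2\<close>.\<close>
  have "bcoeff H 0 (Suc 0) = 0"
    using dvd_lin[OF 1(3)] 1 by (auto simp: bcoeff_power_low X)
  then show False using dvd_lin[OF 2(3)] 2 by (auto simp: bcoeff_power_low X)
qed

end

lemma coordinate_wdeg_pos:
  assumes "F \<circ>\<^sub>P G = id_pmap" "a > 0" "b > 0"
  shows "wdeg a b (F $ 1) > 0"
proof (rule ccontr)
  assume "\<not> wdeg a b (F $ 1) > 0"
  then obtain c where c: "F $ 1 = const2 c" using wdeg_eq_0_imp_const assms by blast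
  have "const2 c = X\<^sub>1"
    using arg_cong[OF assms(1), of "\<lambda>F. F $ 1"] c by simp
  then show False by (simp add: const2_def X\<^sub>1_def)
qed

lemma coordinate_top:
  fixes F :: "'a::field pmap"
  assumes FG: "F \<circ>\<^sub>P G = id_pmap" "G \<circ>\<^sub>P F = id_pmap" and ab: "a > 0" "b > 0"
  obtains P c k where "wtop a b (F $ 1) = const2 c * P ^ k" "c \<noteq> 0" "wtop a b P = P"
    "bcoeff P (Suc 0) 0 \<noteq> 0 \<or> bcoeff P 0 (Suc 0) \<noteq> 0"
proof -
  define f where "f = wtop a b (F $ 1)"
  note pos = coordinate_wdeg_pos[OF FG(1) ab]
  have f: "f \<noteq> 0" "wdeg a b f > 0" 
    using pos unfolding f_def by (auto simp only: wdeg_wtop leading_coeff_0_iff degree_0)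
  have top_f: "wtop a b f = f" unfolding f_def by (rule wtop_wtop)
  define Q where "Q P \<longleftrightarrow> P dvd f \<and> wtop a b P = P \<and> wdeg a b P > 0" for P
  have "Q f" using f top_f by (simp add: Q_def)
  then obtain P where P: "Q P" "\<And>R. Q R \<Longrightarrow> wdeg a b P \<le> wdeg a b R"
    using ex_has_least_nat[of Q _ "wdeg a b"] by blast
  have P0: "P \<noteq> 0" using P(1) by (auto simp: Q_def)
  have unit: "r dvd 1" if "wdeg a b r = 0" "r \<noteq> 0" for r :: "'a bpoly"
    using wdeg_eq_0_imp_const[OF ab that(1)] const2_dvd_1 that(2) by (metis const2_eq_0_iff)
  have "irreducible P"
  proof (rule irreducibleI)
    show "P \<noteq> 0" by fact
    show "\<not> P dvd 1"
    proof
      assume "P dvd 1"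
      then obtain u where u: "1 = P * u" by (elim dvdE)
      then have "u \<noteq> 0" by auto
      then have "wdeg a b (P * u) = wdeg a b P + wdeg a b u" using P0 by (intro wdeg_mult)
      then show False using P(1) unfolding u[symmetric] by (simp add: Q_def)
    qed
    fix r s assume rs: "P = r * s"
    have nz: "r \<noteq> 0" "s \<noteq> 0" using P0 rs by auto
    have deg: "wdeg a b P = wdeg a b r + wdeg a b s" using rs nz by (simp add: wdeg_mult)
    have minimal: "wdeg a b q = 0 \<or> wdeg a b P \<le> wdeg a b q" if "wtop a b q dvd f" for q
    proof (cases "wdeg a b q = 0")
      case False
      then have "Q (wtop a b q)"
        unfolding Q_def using that by (intro conjI) (assumption, rule wtop_wtop, simp)
      then have "wdeg a b P \<le> wdeg a b (wtop a b q)" by (rule P(2))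
      then show ?thesis by simp
    qed simp
    \<comment> \<open>\<open>P\<close> is its own leading form, so the leading forms of
      \<open>r\<close> and \<open>s\<close> are homogeneous divisors of \<open>f\<close>, to which
      the minimality of \<open>P\<close> applies.\<close>
    have "wtop a b r * wtop a b s = P"
      using P(1) unfolding Q_def by (simp only: rs wtop_mult)
    then have "wtop a b r * wtop a b s dvd f" using P(1) by (simp only: Q_def)
    then have "wtop a b r dvd f" "wtop a b s dvd f" by (rule dvd_mult_left, rule dvd_mult_right)
    then have "wdeg a b r = 0 \<or> wdeg a b P \<le> wdeg a b r" "wdeg a b s = 0 \<or> wdeg a b P \<le> wdeg a b s"
      using minimal by blast+
    then show "r dvd 1 \<or> s dvd 1" using deg unit[OF _ nz(1)] unit[OF _ nz(2)] by linarith
  qed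
  \<comment> \<open>The ring is factorial, so irreducible elements are prime.\<close>
  then have "prime_elem P" by simp
  then interpret graded_prime a b P using ab P(1) by unfold_locales (simp_all add: Q_def)
  have F0: "F $ 1 \<noteq> 0" using pos by auto
  have "P ^ 1 dvd wtop a b (F $ 1)" using P(1) unfolding Q_def f_def by (simp only: power_one_right)
  then have e: "e (F $ 1) > 0" using e_dvd_iff[OF F0, of 1] by linarith
  obtain c where "c \<noteq> 0" "wtop a b (F $ 1) = const2 c * P ^ e (F $ 1)"
    by (rule balanced_imp_top[OF F0]) (simp_all add: top_eq_const_prime_power[OF FG e pos])
  with linear_part_prime[OF FG e pos] show ?thesis using that wtop_P by blast
qed

section \<open>Triangular maps and their linear conjugates\<close>

definition swap_pmap :: "'a::field pmap" where "swap_pmap = vector [X\<^sub>2, X\<^sub>1]"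

lemma swap_pmap_nth [simp]: "swap_pmap $ 1 = X\<^sub>2" "swap_pmap $ 2 = X\<^sub>1"
  by (simp_all add: swap_pmap_def)

lemma diag_pmap_nth [simp]: "diag_pmap a b $ 1 = const2 a * X\<^sub>1" "diag_pmap a b $ 2 = const2 b * X\<^sub>2"
  by (simp_all add: diag_pmap_def)

definition uni_subst :: "'a::field poly \<Rightarrow> 'a bpoly \<Rightarrow> 'a bpoly" where
  "uni_subst q s = poly (map_poly const2 q) s"

interpretation uni_subst: comm_ring_hom "\<lambda>q. uni_subst q s"
  unfolding uni_subst_def by (intro comm_ring_hom_poly_map_poly comm_ring_hom_const2)

lemma uni_subst_pCons [simp]: "uni_subst (pCons c q) s = const2 c + s * uni_subst q s"
  by (simp add: uni_subst_def Polynomial.map_poly_pCons)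

lemma uni_subst_0 [simp]: "uni_subst 0 s = 0"
  by (simp add: uni_subst_def)

lemma uni_subst_smult: "uni_subst (smult c q) s = const2 c * uni_subst q s"
  by (induction q) (simp_all add: const2_mult algebra_simps)

lemma subst2_uni_subst [simp]: "subst2 (uni_subst q s) F = uni_subst q (subst2 s F)"
  by (induction q) (simp_all add: subst2.hom_add subst2.hom_mult)

lemma uni_subst_pcompose: "uni_subst (pcompose q r) s = uni_subst q (uni_subst r s)"
  by (induction q) (simp_all add: pcompose_pCons uni_subst.hom_add uni_subst.hom_mult)

lemma uni_subst_X1: "uni_subst q X\<^sub>1 = [:q:]"
  by (induction q) (simp_all add: const2_def X\<^sub>1_def)

lemma triangular_pmap_nth [simp]:
  "triangular_pmap q c $ 1 = X\<^sub>1 + uni_subst q X\<^sub>2" "triangular_pmap q c $ 2 = X\<^sub>2 + const2 c"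
  by (simp_all add: triangular_pmap_def uni_subst_def)

lemma linear_pmap_nth [simp]:
  "linear_pmap A $ i = const2 (A $ i $ 1) * X\<^sub>1 + const2 (A $ i $ 2) * X\<^sub>2"
  by (simp add: linear_pmap_def sum_2)

lemma linear_pmap_comp: "linear_pmap A \<circ>\<^sub>P linear_pmap B = linear_pmap (A ** B)"
  by (rule pmap_eqI)
     (simp_all add: subst2.hom_add subst2.hom_mult matrix_matrix_mult_def sum_2 const2_add const2_mult algebra_simps)

lemma linear_pmap_id [simp]: "linear_pmap (mat 1) = id_pmap"
  by (rule pmap_eqI) (simp_all add: Finite_Cartesian_Product.mat_def)

lemma matrix_inv_inverse:
  fixes W :: "'a::field ^ 'n ^ 'n"
  assumes "invertible W"
  shows "W ** matrix_inv W = mat 1" "matrix_inv W ** W = mat 1"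
  using assms someI_ex[of "\<lambda>V. W ** V = mat 1 \<and> V ** W = mat 1"]
  by (simp_all add: invertible_def matrix_inv_def)

lemma matrix_inv_eqI:
  fixes V W :: "'a::field ^ 'n ^ 'n"
  assumes "V ** W = mat 1" "W ** V = mat 1"
  shows "invertible W" "matrix_inv W = V"
proof -
  show inv: "invertible W" using assms by (auto simp: invertible_def)
  have "matrix_inv W = (V ** W) ** matrix_inv W" by (simp add: assms)
  also have "\<dots> = V" by (simp add: matrix_mul_assoc[symmetric] matrix_inv_inverse[OF inv])
  finally show "matrix_inv W = V" .
qed

lemma conj_triangularI:
  "V ** W = mat 1 \<Longrightarrow> W ** V = mat 1 \<Longrightarrow>
    conj_triangular (linear_pmap V \<circ>\<^sub>P triangular_pmap q c \<circ>\<^sub>P linear_pmap W)"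
  unfolding conj_triangular_def using matrix_inv_eqI by metis

lemma conj_triangularE:
  assumes "conj_triangular P"
  obtains V W q c where "V ** W = mat 1" "W ** V = mat 1"
    "P = linear_pmap V \<circ>\<^sub>P triangular_pmap q c \<circ>\<^sub>P linear_pmap W"
  using assms matrix_inv_inverse unfolding conj_triangular_def by metis

lemma conj_triangular_triangular: "conj_triangular (triangular_pmap q c)"
  using conj_triangularI[of "mat 1" "mat 1" q c] by simp

lemma pmap_automorphism_triangular: "pmap_automorphism (triangular_pmap q c)"
proof -
  define T where "T = (vector [X\<^sub>1 - uni_subst q (X\<^sub>2 - const2 c), X\<^sub>2 - const2 c] :: 'a pmap)"
  have T: "T $ 1 = X\<^sub>1 - uni_subst q (X\<^sub>2 - const2 c)" "T $ 2 = X\<^sub>2 - const2 c" by (simp_all add: T_def)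
  have "triangular_pmap q c \<circ>\<^sub>P T = id_pmap"
    by (rule pmap_eqI) (simp_all add: T subst2.hom_add)
  moreover have "T \<circ>\<^sub>P triangular_pmap q c = id_pmap"
    by (rule pmap_eqI) (simp_all add: T subst2.hom_minus)
  ultimately show ?thesis by (auto simp: pmap_automorphism_def)
qed

lemma pmap_automorphism_comp:
  assumes "pmap_automorphism F" "pmap_automorphism G"
  shows "pmap_automorphism (F \<circ>\<^sub>P G)"
proof -
  obtain F' G' where "F \<circ>\<^sub>P F' = id_pmap" "F' \<circ>\<^sub>P F = id_pmap" "G \<circ>\<^sub>P G' = id_pmap" "G' \<circ>\<^sub>P G = id_pmap"
    using assms by (auto simp: pmap_automorphism_def)
  then have "(F \<circ>\<^sub>P G) \<circ>\<^sub>P (G' \<circ>\<^sub>P F') = id_pmap" "(G' \<circ>\<^sub>P F') \<circ>\<^sub>P (F \<circ>\<^sub>P G) = id_pmap"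
    by (metis comp_pmap_assoc comp_id_pmap)+
  then show ?thesis unfolding pmap_automorphism_def by blast
qed

lemma linear_pmap_inverse: "V ** W = mat 1 \<Longrightarrow> linear_pmap V \<circ>\<^sub>P linear_pmap W = id_pmap"
  by (simp add: linear_pmap_comp)

lemma pmap_automorphism_conj_triangular:
  assumes "conj_triangular P"
  shows "pmap_automorphism P"
proof -
  obtain V W q c where "V ** W = mat 1" "W ** V = mat 1"
    and P: "P = linear_pmap V \<circ>\<^sub>P triangular_pmap q c \<circ>\<^sub>P linear_pmap W"
    using assms by (rule conj_triangularE)
  then have "pmap_automorphism (linear_pmap V)" "pmap_automorphism (linear_pmap W)"
    unfolding pmap_automorphism_def using linear_pmap_inverse by blast+
  then show ?thesis unfolding P by (intro pmap_automorphism_comp pmap_automorphism_triangular)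
qed

section \<open>Iterates and order in positive characteristic\<close>

lemma pmap_power_0 [simp]: "pmap_power F 0 = id_pmap"
  and pmap_power_Suc: "pmap_power F (Suc k) = F \<circ>\<^sub>P pmap_power F k"
  by (simp_all add: pmap_power_def)

lemma pmap_power_conj:
  assumes "V \<circ>\<^sub>P W = id_pmap" "W \<circ>\<^sub>P V = id_pmap"
  shows "pmap_power (V \<circ>\<^sub>P T \<circ>\<^sub>P W) k = V \<circ>\<^sub>P pmap_power T k \<circ>\<^sub>P W"
proof (induction k)
  case (Suc k)
  have "V \<circ>\<^sub>P T \<circ>\<^sub>P W \<circ>\<^sub>P V \<circ>\<^sub>P pmap_power T k \<circ>\<^sub>P W = V \<circ>\<^sub>P T \<circ>\<^sub>P (W \<circ>\<^sub>P V) \<circ>\<^sub>P pmap_power T k \<circ>\<^sub>P W"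
    by (simp only: comp_pmap_assoc)
  then show ?case by (simp add: pmap_power_Suc Suc assms(2) comp_pmap_assoc)
qed (simp add: assms(1))

text \<open>Each iteration shifts \<open>X\<^sub>2\<close> by \<open>c\<close>, so the first
  component accumulates \<open>q\<close> along the orbit of \<open>X\<^sub>2\<close>.\<close>

lemma pmap_power_triangular:
  "pmap_power (triangular_pmap q c) n $ 1 = X\<^sub>1 + (\<Sum>i<n. uni_subst q (X\<^sub>2 + const2 (of_nat i * c)))"
  "pmap_power (triangular_pmap q c) n $ 2 = X\<^sub>2 + const2 (of_nat n * c)"
proof -
  have "pmap_power (triangular_pmap q c) n $ 1 = X\<^sub>1 + (\<Sum>i<n. uni_subst q (X\<^sub>2 + const2 (of_nat i * c)))
    \<and> pmap_power (triangular_pmap q c) n $ 2 = X\<^sub>2 + const2 (of_nat n * c)"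
    by (induction n) (simp_all add: pmap_power_Suc subst2.hom_add const2_add algebra_simps)
  then show "pmap_power (triangular_pmap q c) n $ 1 = X\<^sub>1 + (\<Sum>i<n. uni_subst q (X\<^sub>2 + const2 (of_nat i * c)))"
    "pmap_power (triangular_pmap q c) n $ 2 = X\<^sub>2 + const2 (of_nat n * c)" by simp_all
qed

lemma of_nat_CHAR_bpoly: "of_nat CHAR('a) = (0 :: 'a::field bpoly)"
proof -
  interpret comm_ring_hom "const2 :: 'a \<Rightarrow> _" by (rule comm_ring_hom_const2)
  show ?thesis using hom_of_nat[of "CHAR('a)"] by simp
qed

lemma pmap_power_CHAR_triangular:
  "pmap_power (triangular_pmap q (c :: 'a::field)) (CHAR('a)\<^sup>2) = id_pmap"
proof (rule pmap_eqI)
  define p where "p = CHAR('a)"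
  have p0: "of_nat p = (0 :: 'a)" by (simp add: p_def)
  define g where "g i = uni_subst q (X\<^sub>2 + const2 (of_nat i * c))" for i
  \<comment> \<open>\<open>g\<close> has period \<open>p\<close>, so the sum consists of \<open>p\<close> equal blocks.\<close>
  have "(\<Sum>i<p\<^sup>2. g i) = (\<Sum>m<p. \<Sum>i=m * p..<m * p + p. g i)"
    by (simp add: sum.nat_group power2_eq_square)
  also have "\<dots> = (\<Sum>m<p. \<Sum>i<p. g i)"
  proof (rule sum.cong)
    fix m
    have "(\<Sum>i=m * p..<m * p + p. g i) = (\<Sum>i=0..<p. g (i + m * p))"
      using sum.shift_bounds_nat_ivl[of g 0 "m * p" p] by (simp add: add.commute)
    also have "\<dots> = (\<Sum>i=0..<p. g i)" by (simp add: g_def p0)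
    finally show "(\<Sum>i=m * p..<m * p + p. g i) = (\<Sum>i<p. g i)" by (simp add: atLeast0LessThan)
  qed simp
  also have "\<dots> = of_nat p * (\<Sum>i<p. g i)" by simp
  also have "\<dots> = 0" by (simp add: p_def of_nat_CHAR_bpoly)
  finally have "(\<Sum>i<p\<^sup>2. g i) = 0" .
  then show "pmap_power (triangular_pmap q c) (CHAR('a)\<^sup>2) $ 1 = id_pmap $ 1"
    by (simp add: pmap_power_triangular g_def p_def)
  show "pmap_power (triangular_pmap q c) (CHAR('a)\<^sup>2) $ 2 = id_pmap $ 2"
    by (simp add: pmap_power_triangular power2_eq_square)
qed

lemma pmap_power_CHAR_conj_triangular:
  assumes "conj_triangular (P :: 'a::field pmap)"
  shows "pmap_power P (CHAR('a)\<^sup>2) = id_pmap"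
proof -
  obtain V W q c where "V ** W = mat 1" "W ** V = mat 1"
    and P: "P = linear_pmap V \<circ>\<^sub>P triangular_pmap q c \<circ>\<^sub>P linear_pmap W"
    using assms by (rule conj_triangularE)
  then have VW: "linear_pmap V \<circ>\<^sub>P linear_pmap W = id_pmap" "linear_pmap W \<circ>\<^sub>P linear_pmap V = id_pmap"
    by (simp_all add: linear_pmap_inverse)
  show ?thesis unfolding P by (simp add: pmap_power_conj[OF VW] pmap_power_CHAR_triangular VW)
qed

section \<open>Pascal finiteness\<close>

lemma Delta_add: "Delta F (P + Q) = Delta F P + Delta F Q"
  and Delta_const2_mult: "Delta F (const2 c * P) = const2 c * Delta F P"
  and Delta_0 [simp]: "Delta F 0 = 0"
  by (simp_all add: Delta_def subst2.hom_add subst2.hom_mult algebra_simps)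

lemma Delta_power_linear:
  "(Delta F ^^ m) (const2 a * P + const2 b * Q) = const2 a * (Delta F ^^ m) P + const2 b * (Delta F ^^ m) Q"
  by (induction m) (simp_all add: Delta_add Delta_const2_mult)

text \<open>The shift keeps degree and leading coefficient, so leading terms cancel. The disjunction
  with 0 lets the bound descend to \<open>m = 0\<close>.\<close>

lemma degree_pcompose_shift_diff:
  "q = 0 \<or> degree q < Suc m \<Longrightarrow> pcompose q [:c, 1:] - q = 0 \<or> degree (pcompose q [:c, 1:] - q) < m"
  for q :: "'a::field poly"
proof (cases "degree q = 0")
  case True
  then show ?thesis by (auto elim!: degree_eq_zeroE)
next
  case False
  assume "q = 0 \<or> degree q < Suc m"
  with False have "degree q \<le> m" by auto
  have deg: "degree (pcompose q [:c, 1:]) = degree q" by (simp add: degree_pcompose)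
  have "lead_coeff (pcompose q [:c, 1:]) = lead_coeff q" by (subst lead_coeff_comp) simp_all
  then have "coeff (pcompose q [:c, 1:] - q) (degree q) = 0" by (simp add: deg)
  moreover have "degree (pcompose q [:c, 1:] - q) \<le> degree q" by (rule degree_diff_le) (simp_all add: deg)
  ultimately have "pcompose q [:c, 1:] - q = 0 \<or> degree (pcompose q [:c, 1:] - q) < degree q"
    by (intro eq_zero_or_degree_less)
  then show ?thesis using \<open>degree q \<le> m\<close> by auto
qed

text \<open>On polynomials in \<open>X\<^sub>2\<close> the operator is the finite difference with
  step \<open>c\<close>, which lowers the degree.\<close>

lemma Delta_power_triangular_uni_subst:
  "r = 0 \<or> degree r < m \<Longrightarrow> (Delta (triangular_pmap q c) ^^ m) (uni_subst r X\<^sub>2) = 0"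
proof (induction m arbitrary: r)
  case (Suc m)
  have "Delta (triangular_pmap q c) (uni_subst r X\<^sub>2) = uni_subst (pcompose r [:c, 1:] - r) X\<^sub>2"
    by (simp add: Delta_def uni_subst.hom_minus uni_subst_pcompose add.commute)
  then show ?case
    using Suc.IH[OF degree_pcompose_shift_diff[OF Suc.prems, of c]] by (simp add: funpow_Suc_right del: funpow.simps)
qed simp

text \<open>Substituting \<open>W\<close> intertwines the operators of the triangular map and of
  \<open>P\<close>, so nilpotency carries over.\<close>

lemma pascal_finite_conj_triangular:
  assumes "conj_triangular P"
  shows "pascal_finite P"
proof -
  obtain V W q c where "V ** W = mat 1" "W ** V = mat 1"
    and P: "P = linear_pmap V \<circ>\<^sub>P triangular_pmap q c \<circ>\<^sub>P linear_pmap W"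
    using assms by (rule conj_triangularE)
  then have VW: "linear_pmap V \<circ>\<^sub>P linear_pmap W = id_pmap" "linear_pmap W \<circ>\<^sub>P linear_pmap V = id_pmap"
    by (simp_all add: linear_pmap_inverse)
  let ?T = "triangular_pmap q c"
  \<comment> \<open>One step turns \<open>X\<^sub>1\<close> into \<open>q(X\<^sub>2)\<close>, and
    the other \<open>degree q + 2\<close> annihilate that; \<open>m\<close> also exceeds the degree
    1 of \<open>X\<^sub>2\<close>.\<close>
  define m where "m = degree q + 3"
  have "(Delta ?T ^^ Suc (degree q + 2)) X\<^sub>1 = (Delta ?T ^^ (degree q + 2)) (uni_subst q X\<^sub>2)"
    by (simp add: funpow_Suc_right Delta_def del: funpow.simps)
  then have X1: "(Delta ?T ^^ m) X\<^sub>1 = 0"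
    using Delta_power_triangular_uni_subst[of q "degree q + 2" q c] by (simp add: m_def numeral_3_eq_3)
  have X2: "(Delta ?T ^^ m) X\<^sub>2 = 0"
    using Delta_power_triangular_uni_subst[of "[:0, 1:]" m q c] by (simp add: m_def)
  have "subst2 (subst2 h (linear_pmap W)) P = subst2 (subst2 h ?T) (linear_pmap W)" for h
  proof -
    have "linear_pmap W \<circ>\<^sub>P P = (linear_pmap W \<circ>\<^sub>P linear_pmap V) \<circ>\<^sub>P ?T \<circ>\<^sub>P linear_pmap W"
      unfolding P by (simp only: comp_pmap_assoc)
    then show ?thesis by (simp add: subst2_subst2 VW)
  qed
  then have "Delta P (subst2 h (linear_pmap W)) = subst2 (Delta ?T h) (linear_pmap W)" for h
    by (simp add: Delta_def subst2.hom_minus)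
  then have conj: "(Delta P ^^ k) (subst2 h (linear_pmap W)) = subst2 ((Delta ?T ^^ k) h) (linear_pmap W)" for k h
    by (induction k) simp_all
  have "(Delta P ^^ m) (id_pmap $ i) = 0" for i
  proof -
    \<comment> \<open>Each coordinate is the image under \<open>W\<close> of a component of
      \<open>V\<close>, a linear form in \<open>X\<^sub>1\<close> and
      \<open>X\<^sub>2\<close>.\<close>
    have "id_pmap $ i = subst2 (linear_pmap V $ i) (linear_pmap W)" using VW(1) by (metis comp_pmap_nth)
    then have "(Delta P ^^ m) (id_pmap $ i) = subst2 ((Delta ?T ^^ m) (linear_pmap V $ i)) (linear_pmap W)"
      by (simp only: conj)
    then show ?thesis by (simp add: Delta_power_linear X1 X2)
  qed
  then show ?thesis unfolding pascal_finite_def by (intro exI[of _ m]) (simp add: m_def)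
qed

section \<open>Tame maps\<close>

lemma map_poly_pderiv_mult:
  fixes p q :: "'a::field bpoly"
  shows "map_poly pderiv (p * q) = p * map_poly pderiv q + map_poly pderiv p * q"
proof -
  have "pderiv (r * s) = r * pderiv s + pderiv r * s" for r s :: "'a poly"
    by (simp add: pderiv_mult mult.commute)
  then show ?thesis
    by (simp add: poly_eq_iff[of "map_poly pderiv (p * q)"] coeff_map_poly coeff_mult
        higher_pderiv_sum[of 1, simplified] sum.distrib)
qed

lemma partial2_add: "partial2 j (p + q) = partial2 j p + partial2 j q"
  by (simp add: partial2_def pderiv_add poly_eq_iff[of "map_poly pderiv (p + q)"] coeff_map_poly)

lemma partial2_mult: "partial2 j (p * q) = p * partial2 j q + partial2 j p * q"
  by (simp add: partial2_def pderiv_mult map_poly_pderiv_mult mult.commute)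

lemma partial2_const2 [simp]: "partial2 j (const2 c) = 0"
  by (simp add: partial2_def const2_def pderiv_pCons map_poly_const)

lemma partial2_X [simp]:
  "partial2 1 X\<^sub>1 = 1" "partial2 2 X\<^sub>1 = 0" "partial2 1 X\<^sub>2 = 0" "partial2 2 X\<^sub>2 = 1"
  by (simp_all add: partial2_def X\<^sub>1_def X\<^sub>2_def pderiv_pCons map_poly_const Polynomial.map_poly_pCons map_poly_1)

text \<open>The chain rule: both sides are additive and obey the same product rule, so it suffices
  to check generators.\<close>

lemma partial2_subst2:
  "partial2 j (subst2 p G) = subst2 (partial2 1 p) G * partial2 j (G $ 1) + subst2 (partial2 2 p) G * partial2 j (G $ 2)"
proof (induction p rule: bpoly_induct)
  case (add p q)
  then show ?case by (simp add: subst2.hom_add partial2_add algebra_simps)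
next
  case (mult p q)
  then show ?case by (simp add: subst2.hom_mult subst2.hom_add partial2_mult algebra_simps)
qed simp_all

lemma det_jacobian_comp:
  "det (jacobian_pmap (F \<circ>\<^sub>P G)) = subst2 (det (jacobian_pmap F)) G * det (jacobian_pmap G)"
  by (simp add: det_2 jacobian_pmap_def partial2_subst2 subst2.hom_minus subst2.hom_mult algebra_simps)

lemma det_jacobian_linear: "det (jacobian_pmap (linear_pmap A)) = const2 (det A)"
  by (simp add: det_2 jacobian_pmap_def partial2_add partial2_mult const2_diff const2_mult)

lemma partial2_1_uni_subst_X2: "partial2 1 (uni_subst q X\<^sub>2) = 0"
  by (induction q) (simp_all add: partial2_add partial2_mult, simp add: partial2_def)

lemma det_jacobian_triangular: "det (jacobian_pmap (triangular_pmap q c)) = 1"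
  by (simp add: det_2 jacobian_pmap_def partial2_add partial2_1_uni_subst_X2)

lemma det_jacobian_conj_triangular:
  assumes "conj_triangular P"
  shows "det (jacobian_pmap P) = 1"
proof -
  obtain V W q c where VW: "V ** W = mat 1" "W ** V = mat 1"
    and P: "P = linear_pmap V \<circ>\<^sub>P triangular_pmap q c \<circ>\<^sub>P linear_pmap W"
    using assms by (rule conj_triangularE)
  have "det (jacobian_pmap P) = const2 (det V * det W)"
    unfolding P by (simp add: det_jacobian_comp det_jacobian_linear det_jacobian_triangular const2_mult)
  also have "det V * det W = 1" using VW(1) by (metis det_mul det_I)
  finally show ?thesis by simp
qed

text \<open>Linear transvections are linear conjugates of \<open>(X\<^sub>1 + c X\<^sub>2, X\<^sub>2)\<close>, so they are not needed as factors.\<close>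

definition tame :: "'a::field pmap \<Rightarrow> bool" where
  "tame F \<longleftrightarrow> (\<exists>\<delta>. \<delta> \<noteq> 0 \<and> det (jacobian_pmap F) = const2 \<delta> \<and>
    (\<exists>Ps. F = diag_pmap \<delta> 1 \<circ>\<^sub>P foldr (\<circ>\<^sub>P) Ps id_pmap \<and> (\<forall>P\<in>set Ps. conj_triangular P)))"

lemma det_jacobian_diag: "det (jacobian_pmap (diag_pmap a b)) = const2 (a * b)"
  by (simp add: det_2 jacobian_pmap_def partial2_mult const2_mult)

lemma det_jacobian_id: "det (jacobian_pmap id_pmap) = 1"
  by (simp add: det_2 jacobian_pmap_def)

text \<open>The factors after the diagonal one have Jacobian determinant 1, so the condition on the
  determinant is automatic.\<close>

lemma tameI:
  assumes "\<delta> \<noteq> 0" "F = diag_pmap \<delta> 1 \<circ>\<^sub>P foldr (\<circ>\<^sub>P) Ps id_pmap" "\<And>P. P \<in> set Ps \<Longrightarrow> conj_triangular P"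
  shows "tame F"
proof -
  have "det (jacobian_pmap (foldr (\<circ>\<^sub>P) Ps id_pmap)) = 1"
    using assms(3) by (induction Ps) (simp_all add: det_jacobian_id det_jacobian_comp det_jacobian_conj_triangular)
  then have "det (jacobian_pmap F) = const2 \<delta>" by (simp add: assms(2) det_jacobian_comp det_jacobian_diag)
  with assms show ?thesis unfolding tame_def by blast
qed

lemma diag_pmap_eq_linear: "diag_pmap a b = linear_pmap (vector [vector [a, 0], vector [0, b]])"
  by (rule pmap_eqI) simp_all

lemma diag_pmap_1 [simp]: "diag_pmap 1 1 = id_pmap"
  by (rule pmap_eqI) simp_all

lemma diag_pmap_comp: "diag_pmap a b \<circ>\<^sub>P diag_pmap c d = diag_pmap (a * c) (b * d)"
  by (rule pmap_eqI) (simp_all add: subst2.hom_mult const2_mult)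

section \<open>Moving diagonal factors to the front\<close>

lemma conj_triangular_linear_conj:
  assumes "conj_triangular P" "A ** B = mat 1" "B ** A = mat 1"
  shows "conj_triangular (linear_pmap A \<circ>\<^sub>P P \<circ>\<^sub>P linear_pmap B)"
proof -
  obtain V W q c where VW: "V ** W = mat 1" "W ** V = mat 1"
    and P: "P = linear_pmap V \<circ>\<^sub>P triangular_pmap q c \<circ>\<^sub>P linear_pmap W"
    using assms(1) by (rule conj_triangularE)
  have "linear_pmap A \<circ>\<^sub>P P \<circ>\<^sub>P linear_pmap B =
      linear_pmap (A ** V) \<circ>\<^sub>P triangular_pmap q c \<circ>\<^sub>P linear_pmap (W ** B)"
    unfolding P linear_pmap_comp[symmetric] by (simp only: comp_pmap_assoc)
  moreover have "(A ** V) ** (W ** B) = mat 1"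
    by (metis VW(1) assms(2) matrix_mul_assoc matrix_mul_lid)
  moreover have "(W ** B) ** (A ** V) = mat 1"
    by (metis VW(2) assms(3) matrix_mul_assoc matrix_mul_lid)
  ultimately show ?thesis using conj_triangularI by metis
qed

lemma conj_triangular_diag_conj:
  assumes "conj_triangular P" "\<delta> \<noteq> 0"
  shows "conj_triangular (diag_pmap (inverse \<delta>) 1 \<circ>\<^sub>P P \<circ>\<^sub>P diag_pmap \<delta> 1)"
  unfolding diag_pmap_eq_linear
  by (rule conj_triangular_linear_conj[OF assms(1)])
     (use assms(2) in \<open>simp_all add: Finite_Cartesian_Product.vec_eq_iff forall_2 matrix_matrix_mult_def sum_2 Finite_Cartesian_Product.mat_def\<close>)

lemma foldr_comp_append:
  "foldr (\<circ>\<^sub>P) (Ps @ Qs) id_pmap = foldr (\<circ>\<^sub>P) Ps id_pmap \<circ>\<^sub>P foldr (\<circ>\<^sub>P) Qs id_pmap"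
  by (induction Ps) (simp_all add: comp_pmap_assoc)

lemma foldr_comp_conj:
  assumes "V \<circ>\<^sub>P W = id_pmap" "W \<circ>\<^sub>P V = id_pmap"
  shows "foldr (\<circ>\<^sub>P) (map (\<lambda>P. V \<circ>\<^sub>P P \<circ>\<^sub>P W) Ps) id_pmap = V \<circ>\<^sub>P foldr (\<circ>\<^sub>P) Ps id_pmap \<circ>\<^sub>P W"
proof (induction Ps)
  case (Cons P Ps)
  have "(V \<circ>\<^sub>P P \<circ>\<^sub>P W) \<circ>\<^sub>P V \<circ>\<^sub>P foldr (\<circ>\<^sub>P) Ps id_pmap \<circ>\<^sub>P W =
      V \<circ>\<^sub>P P \<circ>\<^sub>P (W \<circ>\<^sub>P V) \<circ>\<^sub>P foldr (\<circ>\<^sub>P) Ps id_pmap \<circ>\<^sub>P W"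
    by (simp only: comp_pmap_assoc)
  then show ?case by (simp add: Cons assms(2) comp_pmap_assoc)
qed (simp add: assms(1))

text \<open>The inner diagonal factor passes the factors of \<open>F\<close> by conjugating each of
  them, then merges with the outer one.\<close>

lemma tame_comp:
  assumes "tame F" "tame G"
  shows "tame (F \<circ>\<^sub>P G)"
proof -
  obtain a Ps where F: "a \<noteq> 0" "F = diag_pmap a 1 \<circ>\<^sub>P foldr (\<circ>\<^sub>P) Ps id_pmap" "\<forall>P\<in>set Ps. conj_triangular P"
    using assms(1) by (auto simp: tame_def)
  obtain b Qs where G: "b \<noteq> 0" "G = diag_pmap b 1 \<circ>\<^sub>P foldr (\<circ>\<^sub>P) Qs id_pmap" "\<forall>P\<in>set Qs. conj_triangular P"
    using assms(2) by (auto simp: tame_def)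
  let ?D = "diag_pmap b 1" and ?E = "diag_pmap (inverse b) 1"
  have DE: "?D \<circ>\<^sub>P ?E = id_pmap" "?E \<circ>\<^sub>P ?D = id_pmap" using G(1) by (simp_all add: diag_pmap_comp)
  define Ps' where "Ps' = map (\<lambda>P. ?E \<circ>\<^sub>P P \<circ>\<^sub>P ?D) Ps"
  have "F \<circ>\<^sub>P G = diag_pmap (a * b) 1 \<circ>\<^sub>P foldr (\<circ>\<^sub>P) (Ps' @ Qs) id_pmap"
  proof -
    have "diag_pmap (a * b) 1 \<circ>\<^sub>P foldr (\<circ>\<^sub>P) (Ps' @ Qs) id_pmap =
        diag_pmap a 1 \<circ>\<^sub>P (?D \<circ>\<^sub>P ?E) \<circ>\<^sub>P foldr (\<circ>\<^sub>P) Ps id_pmap \<circ>\<^sub>P ?D \<circ>\<^sub>P foldr (\<circ>\<^sub>P) Qs id_pmap"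
      unfolding foldr_comp_append Ps'_def foldr_comp_conj[OF DE(2,1)]
      using diag_pmap_comp[of a 1 b 1] by (simp add: comp_pmap_assoc[symmetric])
    then show ?thesis unfolding DE F(2) G(2) by (simp add: comp_pmap_assoc)
  qed
  moreover have "conj_triangular P" if "P \<in> set (Ps' @ Qs)" for P
    using that F(3) G(1,3) by (auto simp: Ps'_def intro: conj_triangular_diag_conj)
  ultimately show ?thesis using F(1) G(1) by (intro tameI[of "a * b" _ "Ps' @ Qs"]) simp_all
qed

lemma tame_conj_triangular: "conj_triangular P \<Longrightarrow> tame P"
  by (rule tameI[of 1 _ "[P]"]) simp_all

lemma tame_diag: "a \<noteq> 0 \<Longrightarrow> tame (diag_pmap a 1)"
  by (rule tameI[of a _ "[]"]) simp_all

lemma tame_triangular: "tame (triangular_pmap q c)"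
  by (intro tame_conj_triangular conj_triangular_triangular)

lemma swap_swap [simp]: "swap_pmap \<circ>\<^sub>P swap_pmap = id_pmap"
  by (rule pmap_eqI) simp_all

lemma tame_swap: "tame (swap_pmap :: 'a::field pmap)"
proof -
  let ?E = "\<lambda>c :: 'a. triangular_pmap [:0, c:] 0"
  let ?A = "vector [vector [0, 1], vector [1, 0]] :: 'a ^ 2 ^ 2"
  have A: "?A ** ?A = mat 1"
    by (simp add: Finite_Cartesian_Product.vec_eq_iff forall_2 matrix_matrix_mult_def sum_2 Finite_Cartesian_Product.mat_def)
  have swap: "swap_pmap = linear_pmap ?A" by (rule pmap_eqI) simp_all
  have lower: "conj_triangular (swap_pmap \<circ>\<^sub>P ?E 1 \<circ>\<^sub>P swap_pmap)"
    unfolding swap by (rule conj_triangularI[OF A A])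
  \<comment> \<open>Elimination writes the swap as three shears, with its determinant -1 absorbed by
    the diagonal map.\<close>
  have "swap_pmap = diag_pmap (- 1) 1 \<circ>\<^sub>P ?E (- 1) \<circ>\<^sub>P (swap_pmap \<circ>\<^sub>P ?E 1 \<circ>\<^sub>P swap_pmap) \<circ>\<^sub>P ?E (- 1)"
    by (rule pmap_eqI) (simp_all add: subst2.hom_add subst2.hom_mult subst2.hom_uminus subst2.hom_minus const2_uminus algebra_simps)
  moreover have "tame \<dots>"
    by (intro tame_comp tame_diag tame_triangular tame_conj_triangular lower) simp
  ultimately show ?thesis by simp
qed

section \<open>Coordinates in one variable\<close>

text \<open>The grading turns substitution into composition of polynomials in \<open>t\<close>,
  where degrees multiply.\<close>

lemma degree_uni_subst: "wdeg a b (uni_subst q s) = degree q * wdeg a b s"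
proof -
  have "grade a b (uni_subst q s) = pcompose (map_poly const2 q) (grade a b s)"
    by (induction q)
       (simp_all add: grade.hom_add grade.hom_mult pcompose_pCons Polynomial.map_poly_pCons)
  then show ?thesis by (simp add: degree_pcompose degree_map_poly)
qed

lemma subst2_eq_pcompose:
  assumes "F $ 1 = X\<^sub>1"
  shows "subst2 P F = pcompose P (F $ 2)"
proof (induction P rule: bpoly_induct)
  case (add p q)
  then show ?case by (simp add: subst2.hom_add pcompose_add)
next
  case (mult p q)
  then show ?case by (simp add: subst2.hom_mult pcompose_mult)
next
  case (const c)
  then show ?case unfolding subst2_gens by (simp add: const2_def)
next
  case X1
  then show ?case unfolding subst2_gens assms by (simp add: X\<^sub>1_def)
next
  case X2
  then show ?case unfolding subst2_gens by (simp add: X\<^sub>2_def pcompose_pCons)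
qed

text \<open>Substitution is now composition in \<open>X\<^sub>2\<close> over
  \<open>K[X\<^sub>1]\<close>. Degrees multiply, so \<open>F $ 2\<close> is linear in
  \<open>X\<^sub>2\<close>, and its leading coefficient is a unit, hence a constant.\<close>

lemma tame_automorphism_fixing_X1:
  assumes FG: "F \<circ>\<^sub>P G = id_pmap" "G \<circ>\<^sub>P F = id_pmap" and F1: "F $ 1 = X\<^sub>1"
  shows "tame F"
proof -
  have eq: "pcompose (G $ 2) (F $ 2) = X\<^sub>2"
    using arg_cong[OF FG(2), of "\<lambda>F. F $ 2"] by (simp add: subst2_eq_pcompose[OF F1])
  have "degree (G $ 2) * degree (F $ 2) = 1"
    using arg_cong[OF eq, of degree] by (simp add: degree_pcompose X\<^sub>2_def)
  then have "degree (G $ 2) = 1" "degree (F $ 2) = 1" by simp_all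
  then obtain r s q g where G2: "G $ 2 = [:r, s:]" and F2: "F $ 2 = [:q, g:]"
    by (metis degree1_coeffs)
  have "g dvd 1"
  proof (rule dvdI)
    show "1 = g * s" using eq unfolding G2 F2 X\<^sub>2_def by (simp add: pcompose_pCons mult.commute)
  qed
  then obtain c where c: "g = [:c:]" "c \<noteq> 0"
    unfolding is_unit_poly_iff by (auto simp: dvd_field_iff)
  let ?B = "diag_pmap c 1 \<circ>\<^sub>P triangular_pmap (smult (inverse c) q) 0"
  have "F = swap_pmap \<circ>\<^sub>P ?B \<circ>\<^sub>P swap_pmap"
  proof (rule pmap_eqI)
    have "(swap_pmap \<circ>\<^sub>P ?B \<circ>\<^sub>P swap_pmap) $ 2 = const2 c * X\<^sub>2 + const2 c * (const2 (inverse c) * [:q:])"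
      by (simp add: subst2.hom_add subst2.hom_mult uni_subst_smult uni_subst_X1 distrib_left)
    also have "const2 c * (const2 (inverse c) * [:q:]) = [:q:]"
      using c(2) by (simp flip: mult.assoc const2_mult)
    finally show "F $ 2 = (swap_pmap \<circ>\<^sub>P ?B \<circ>\<^sub>P swap_pmap) $ 2"
      by (simp add: F2 c(1) const2_def X\<^sub>2_def)
  qed (simp add: F1)
  moreover have "tame \<dots>" using c(2) by (intro tame_comp tame_swap tame_diag tame_triangular)
  ultimately show ?thesis by simp
qed

text \<open>Since \<open>q(G\<^sub>1) = X\<^sub>1\<close>, \<open>q\<close> has degree 1; undoing
  this affine change reduces to the case \<open>F $ 1 = X\<^sub>1\<close>.\<close>

lemma tame_automorphism_univariate:
  assumes FG: "F \<circ>\<^sub>P G = id_pmap" "G \<circ>\<^sub>P F = id_pmap" and F1: "F $ 1 = [:q:]"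
  shows "tame F"
proof -
  have "uni_subst q (G $ 1) = X\<^sub>1"
    using arg_cong[OF FG(1), of "\<lambda>F. F $ 1"] by (simp add: F1 flip: uni_subst_X1)
  then have "degree q * wdeg 1 1 (G $ 1) = wdeg 1 1 (X\<^sub>1 :: 'a bpoly)"
    by (metis degree_uni_subst)
  also have "\<dots> = 1" by (simp add: degree_monom_eq)
  finally have "degree q = 1" by simp
  then obtain b a where q: "q = [:b, a:]" "a \<noteq> 0" by (metis degree1_coeffs)
  have F1': "F $ 1 = const2 a * X\<^sub>1 + const2 b" by (simp add: F1 q const2_def X\<^sub>1_def)
  define A where "A = diag_pmap a 1 \<circ>\<^sub>P triangular_pmap [:b / a:] 0"
  have A: "A $ 1 = const2 a * X\<^sub>1 + const2 b" "A $ 2 = X\<^sub>2"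
    using q(2) by (simp_all add: A_def subst2.hom_add subst2.hom_mult distrib_left flip: const2_mult)
  define B where "B = (vector [const2 (inverse a) * (X\<^sub>1 - const2 b), X\<^sub>2] :: 'a pmap)"
  have B: "B $ 1 = const2 (inverse a) * (X\<^sub>1 - const2 b)" "B $ 2 = X\<^sub>2" by (simp_all add: B_def)
  have inv: "const2 a * (const2 (inverse a) * h) = h" "const2 (inverse a) * (const2 a * h) = h" for h
    using q(2) by (simp_all flip: mult.assoc const2_mult)
  have AB: "A \<circ>\<^sub>P B = id_pmap" "B \<circ>\<^sub>P A = id_pmap"
    by (rule pmap_eqI; simp add: A B subst2.hom_add subst2.hom_minus subst2.hom_mult inv)+
  have tame_A: "tame A" unfolding A_def using q(2) by (intro tame_comp tame_diag tame_triangular)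
  have "tame (F \<circ>\<^sub>P B)"
  proof (rule tame_automorphism_fixing_X1)
    show "(F \<circ>\<^sub>P B) \<circ>\<^sub>P (A \<circ>\<^sub>P G) = id_pmap" "(A \<circ>\<^sub>P G) \<circ>\<^sub>P (F \<circ>\<^sub>P B) = id_pmap"
      by (metis AB FG comp_pmap_assoc comp_id_pmap)+
    show "(F \<circ>\<^sub>P B) $ 1 = X\<^sub>1" by (simp add: F1' B subst2.hom_add subst2.hom_mult inv)
  qed
  then have "tame ((F \<circ>\<^sub>P B) \<circ>\<^sub>P A)" using tame_A by (rule tame_comp)
  then show ?thesis by (simp add: comp_pmap_assoc AB)
qed

section \<open>Weighted degrees under substitution\<close>

lemma grade_subst2:
  assumes "grade a b (E $ 1) = monom (E $ 1) a'" "grade a b (E $ 2) = monom (E $ 2) b'"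
  shows "grade a b (subst2 h E) = map_poly (\<lambda>p. subst2 p E) (grade a' b' h)"
\<comment> \<open>Both sides are homomorphisms in \<open>h\<close>, and homogeneity of the
  components of \<open>E\<close> gives agreement on generators.\<close>
proof (rule bpoly_hom_unique)
  show "comm_ring_hom (\<lambda>h. grade a b (subst2 h E))"
    by (rule comm_ring_hom_compose[OF grade.comm_ring_hom_axioms comm_ring_hom_subst2])
  show "comm_ring_hom (\<lambda>h. map_poly (\<lambda>p. subst2 p E) (grade a' b' h))"
    by (rule comm_ring_hom_compose[OF comm_ring_hom_map_poly[OF comm_ring_hom_subst2] grade.comm_ring_hom_axioms])
  show "grade a b (subst2 (const2 c) E) = map_poly (\<lambda>p. subst2 p E) (grade a' b' (const2 c))" for c
    unfolding subst2_gens grade_gens by (subst map_poly_const) simp_all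
  show "grade a b (subst2 X\<^sub>1 E) = map_poly (\<lambda>p. subst2 p E) (grade a' b' X\<^sub>1)"
    unfolding subst2_gens grade_gens assms by (subst map_poly_monom) simp_all
  show "grade a b (subst2 X\<^sub>2 E) = map_poly (\<lambda>p. subst2 p E) (grade a' b' X\<^sub>2)"
    unfolding subst2_gens grade_gens assms by (subst map_poly_monom) simp_all
qed

lemma wdeg_subst2_swap: "wdeg a b (subst2 h swap_pmap) = wdeg b a h"
proof -
  have le: "wdeg a b (subst2 h swap_pmap) \<le> wdeg b a h" for a b and h :: "'a::field bpoly"
  proof -
    have "grade a b (subst2 h swap_pmap) = map_poly (\<lambda>p. subst2 p swap_pmap) (grade b a h)"
      by (rule grade_subst2) simp_all
    then show ?thesis by (simp only: degree_map_poly_le)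
  qed
  have "wdeg b a (subst2 (subst2 h swap_pmap) swap_pmap) \<le> wdeg a b (subst2 h swap_pmap)" by (rule le)
  then show ?thesis using le[of a b h] by (simp only: subst2_subst2 swap_swap subst2_id le_antisym)
qed

lemma bcoeff_support_bounds:
  assumes "bcoeff h i j \<noteq> 0"
  shows "i \<le> wdeg 1 0 h" "j \<le> wdeg 0 1 h"
  using bcoeff_nonzero_imp_le_wdeg[OF assms, of 1 0] bcoeff_nonzero_imp_le_wdeg[OF assms, of 0 1] by simp_all

lemma bcoeff_monomials:
  "bcoeff (const2 c * X\<^sub>1 ^ m * X\<^sub>2 ^ n) i j = (if i = m \<and> j = n then c else 0)"
  by (simp add: bcoeff_monom flip: bpoly_monom_eq)

lemma bcoeff_wtop:
  "bcoeff (wtop a b h) i j = (if a * i + b * j = wdeg a b h then bcoeff h i j else 0)"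
  by (rule bcoeff_coeff_grade)

text \<open>The linear monomial present fixes the weight of \<open>P\<close>: it is \<open>l\<close>
  if \<open>X\<^sub>1\<close> occurs, leaving room only for a power of \<open>X\<^sub>2\<close>, and
  otherwise the smaller weight \<open>i\<close>, leaving only \<open>X\<^sub>2\<close>.\<close>

lemma homogeneous_linear_part:
  assumes top: "wtop l i P = P" and i: "0 < i" "i \<le> l"
    and lin: "bcoeff P (Suc 0) 0 \<noteq> 0 \<or> bcoeff P 0 (Suc 0) \<noteq> 0"
  shows "(\<exists>\<alpha>. \<alpha> \<noteq> 0 \<and> P = const2 \<alpha> * X\<^sub>2) \<or>
    (\<exists>\<alpha> \<beta> s. \<alpha> \<noteq> 0 \<and> P = const2 \<alpha> * X\<^sub>1 + const2 \<beta> * X\<^sub>2 ^ s \<and> (\<beta> \<noteq> 0 \<longrightarrow> l = i * s))"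
proof -
  define d where "d = wdeg l i P"
  have supp: "l * m + i * n = d" if "bcoeff P m n \<noteq> 0" for m n
    using that bcoeff_coeff_grade[of l i P d m n] top unfolding d_def by (auto split: if_splits)
  show ?thesis
  proof (cases "bcoeff P (Suc 0) 0 = 0")
    case True
    then have nz: "bcoeff P 0 (Suc 0) \<noteq> 0" using lin by simp
    then have d: "d = i" using supp by fastforce
    have row: "m = 0 \<and> n = 1" if mn: "bcoeff P m n \<noteq> 0" for m n
    proof -
      have eq: "l * m + i * n = i" using supp[OF mn] d by simp
      have "m = 0"
      proof (rule ccontr)
        assume "m \<noteq> 0"
        then have "l \<le> l * m" by simp
        then have "l * m = l * 1" "i * n = 0" using eq i by linarith+
        then have "m = 1" "n = 0" using i by (simp_all only: mult_cancel1 mult_is_0) linarith+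
        then show False using mn True by simp
      qed
      then show ?thesis using eq i by simp
    qed
    have "P = const2 (bcoeff P 0 1) * X\<^sub>1 ^ 0 * X\<^sub>2 ^ 1"
    proof (rule bpoly_eqI)
      fix m n
      show "bcoeff P m n = bcoeff (const2 (bcoeff P 0 1) * X\<^sub>1 ^ 0 * X\<^sub>2 ^ 1) m n"
        unfolding bcoeff_monomials using row[of m n] by auto
    qed
    then show ?thesis using nz by auto
  next
    case False
    then have d: "d = l" using supp by fastforce
    have row: "m = 1 \<and> n = 0 \<or> m = 0 \<and> i * n = l" if "bcoeff P m n \<noteq> 0" for m n
    proof -
      have mn: "l * m + i * n = l" using supp[OF that] d by simp
      show ?thesis
      proof (cases "m = 0")
        case m: False
        then have "l \<le> l * m" by simp
        then have "l * m = l" "i * n = 0" using mn by linarith+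
        then show ?thesis using i by simp
      qed (use mn in simp)
    qed
    \<comment> \<open>If \<open>i\<close> does not divide \<open>l\<close>, no power of
      \<open>X\<^sub>2\<close> fits; then \<open>\<beta> = 0\<close> and \<open>s = 1\<close> is a
      dummy.\<close>
    define s where "s = (if i dvd l then l div i else 1)"
    define \<beta> where "\<beta> = (if i dvd l then bcoeff P 0 s else 0)"
    have "P = const2 (bcoeff P 1 0) * X\<^sub>1 ^ 1 * X\<^sub>2 ^ 0 + const2 \<beta> * X\<^sub>1 ^ 0 * X\<^sub>2 ^ s"
    proof (rule bpoly_eqI)
      fix m n
      show "bcoeff P m n = bcoeff (const2 (bcoeff P 1 0) * X\<^sub>1 ^ 1 * X\<^sub>2 ^ 0 + const2 \<beta> * X\<^sub>1 ^ 0 * X\<^sub>2 ^ s) m n"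
      proof (cases "m = 0 \<and> i * n = l")
        case True
        then have "n = s" "i dvd l" using i by (auto simp: s_def)
        then show ?thesis using True unfolding bcoeff_simps bcoeff_monomials by (simp add: \<beta>_def)
      next
        case F: False
        show ?thesis using row[of m n] F i unfolding bcoeff_simps bcoeff_monomials
          by (auto simp: \<beta>_def s_def)
      qed
    qed
    then have "P = const2 (bcoeff P 1 0) * X\<^sub>1 + const2 \<beta> * X\<^sub>2 ^ s" by simp
    moreover have "\<beta> \<noteq> 0 \<longrightarrow> l = i * s" by (simp add: \<beta>_def s_def)
    ultimately show ?thesis using False by (metis One_nat_def)
  qed
qed

section \<open>Degree reduction\<close>

text \<open>The support of \<open>f\<close> lies in an \<open>i\<close> by \<open>l\<close>
  rectangle, and the weights make its antidiagonal a level line. The new leading form is a multiple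
  of a power of \<open>X\<^sub>1\<close>, so the corner \<open>X\<^sub>2 ^ l\<close> disappears and
  everything else stays under the line.\<close>

lemma degree_reduction:
  fixes F :: "'a::field pmap"
  assumes FG: "F \<circ>\<^sub>P G = id_pmap" "G \<circ>\<^sub>P F = id_pmap"
    and i: "i = wdeg 1 0 (F $ 1)" "0 < i" and l: "l = wdeg 0 1 (F $ 1)" "i \<le> l"
  obtains E E' where "E \<circ>\<^sub>P E' = id_pmap" "E' \<circ>\<^sub>P E = id_pmap" "tame E'"
    "wdeg 1 0 ((F \<circ>\<^sub>P E) $ 1) \<le> i" "wdeg 0 1 ((F \<circ>\<^sub>P E) $ 1) < l"
proof -
  define f where "f = F $ 1"
  have f0: "f \<noteq> 0" using i unfolding f_def by (metis degree_0 grade.hom_zero less_irrefl)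
  have l0: "0 < l" using i(2) l(2) by simp
  obtain P c k where top: "wtop l i f = const2 c * P ^ k" and c: "c \<noteq> 0" and PP: "wtop l i P = P"
    and lin: "bcoeff P (Suc 0) 0 \<noteq> 0 \<or> bcoeff P 0 (Suc 0) \<noteq> 0"
    using coordinate_top[OF FG l0 i(2)] unfolding f_def by metis
  obtain j0 where j0: "bcoeff f i j0 \<noteq> 0"
    using wdeg_attained[OF f0, of 1 0] i(1) unfolding f_def by (metis add_cancel_right_right mult_1 mult_zero_left)
  have ge_i: "l * i + i * j0 \<le> wdeg l i f"
    using bcoeff_nonzero_imp_le_wdeg[OF j0, of l i] by simp
  have le: "m \<le> i" "n \<le> l" if "bcoeff f m n \<noteq> 0" for m n
    using bcoeff_support_bounds[OF that] i(1) l(1) by (simp_all add: f_def)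
  have top_exp: "l * m + i * n = wdeg l i f \<and> m \<le> i \<and> n \<le> l" if "bcoeff (wtop l i f) m n \<noteq> 0" for m n
    using that le[of m n] unfolding bcoeff_wtop by (auto split: if_splits)
  from homogeneous_linear_part[OF PP i(2) l(2) lin] show ?thesis
  proof (elim disjE exE conjE)
    fix \<alpha> assume \<alpha>: "\<alpha> \<noteq> 0" "P = const2 \<alpha> * X\<^sub>2"
    interpret const2: comm_ring_hom const2 by (rule comm_ring_hom_const2)
    \<comment> \<open>A leading form in \<open>X\<^sub>2\<close> alone has weight at most
      \<open>l * i\<close>, which forces \<open>X\<^sub>1 ^ i\<close> into it as well, a
      contradiction.\<close>
    have topf: "wtop l i f = const2 (c * \<alpha> ^ k) * X\<^sub>1 ^ 0 * X\<^sub>2 ^ k"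
      unfolding top \<alpha>(2) by (simp add: power_mult_distrib const2_mult const2.hom_power)
    have "bcoeff (wtop l i f) 0 k \<noteq> 0" unfolding topf bcoeff_monomials using c \<alpha> by simp
    with top_exp have D: "wdeg l i f = i * k" "k \<le> l" by fastforce+
    then have "wdeg l i f \<le> l * i" by (simp add: mult.commute)
    then have "i * j0 = 0" and eq: "wdeg l i f = l * i" using ge_i by linarith+
    then have "j0 = 0" using i(2) by simp
    with j0 have "bcoeff (wtop l i f) i 0 \<noteq> 0" by (simp add: bcoeff_coeff_grade eq)
    then show ?thesis unfolding topf bcoeff_monomials using i(2) by simp
  next
    fix \<alpha> \<beta> s assume \<alpha>: "\<alpha> \<noteq> 0" and P: "P = const2 \<alpha> * X\<^sub>1 + const2 \<beta> * X\<^sub>2 ^ s" and s: "\<beta> \<noteq> 0 \<longrightarrow> l = i * s"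
    interpret const2: comm_ring_hom const2 by (rule comm_ring_hom_const2)
    \<comment> \<open>Chosen so that \<open>E\<close> cancels the \<open>X\<^sub>2\<close>-term of
      \<open>P\<close>.\<close>
    define \<gamma> where "\<gamma> = \<beta> / \<alpha>"
    define E where "E = triangular_pmap (monom (- \<gamma>) s) 0"
    define E' where "E' = triangular_pmap (monom \<gamma> s) 0"
    have uni_monom: "uni_subst (monom a s) h = const2 a * h ^ s" for a and h :: "'a bpoly"
      unfolding uni_subst_def by (simp add: map_poly_monom poly_monom)
    have E: "E $ 1 = X\<^sub>1 - const2 \<gamma> * X\<^sub>2 ^ s" "E $ 2 = X\<^sub>2"
      and E': "E' $ 1 = X\<^sub>1 + const2 \<gamma> * X\<^sub>2 ^ s" "E' $ 2 = X\<^sub>2"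
      by (simp_all add: E_def E'_def uni_monom const2_uminus)
    have inv: "E \<circ>\<^sub>P E' = id_pmap" "E' \<circ>\<^sub>P E = id_pmap"
      by (rule pmap_eqI; simp add: E E' subst2.hom_add subst2.hom_minus subst2.hom_mult subst2.hom_power)+
    have PE: "subst2 P E = const2 \<alpha> * X\<^sub>1"
      using \<alpha> by (simp add: P E subst2.hom_add subst2.hom_mult subst2.hom_power right_diff_distrib \<gamma>_def
          flip: mult.assoc const2_mult)
    have "grade l i (E $ 1) = monom (E $ 1) l"
    proof (cases "\<beta> = 0")
      case True
      then show ?thesis by (simp add: E \<gamma>_def)
    next
      case False
      then have "grade l i (const2 \<gamma> * X\<^sub>2 ^ s) = monom (const2 \<gamma> * X\<^sub>2 ^ s) l"
        using s by (simp add: grade.hom_mult grade.hom_power monom_power smult_monom)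
      then show ?thesis by (simp add: E grade.hom_minus diff_monom)
    qed
    then have gradeE: "grade l i (subst2 h E) = map_poly (\<lambda>p. subst2 p E) (grade l i h)" for h
      by (rule grade_subst2) (simp add: E)
    define d where "d = wdeg l i f"
    have topE: "coeff (grade l i (subst2 f E)) d = const2 (c * \<alpha> ^ k) * X\<^sub>1 ^ k * X\<^sub>2 ^ 0"
      unfolding gradeE d_def
      by (simp add: coeff_map_poly top PE subst2.hom_mult subst2.hom_power power_mult_distrib
          const2_mult const2.hom_power)
    have degE: "wdeg l i (subst2 f E) \<le> d"
      unfolding gradeE d_def by (rule degree_map_poly_le)
    have "bcoeff (coeff (grade l i (subst2 f E)) d) k 0 \<noteq> 0"
      unfolding topE bcoeff_monomials using c \<alpha> by simp
    then have d: "d = l * k" by (auto simp: bcoeff_coeff_grade split: if_splits)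
    \<comment> \<open>Setting \<open>X\<^sub>2\<close> to 0 shows that \<open>X\<^sub>1 ^ k\<close>
      survives in the leading form of \<open>f\<close>, whose \<open>X\<^sub>1\<close>-exponents are
      at most \<open>i\<close>.\<close>
    have "k \<le> i"
    proof -
      have "\<beta> = 0 \<or> s \<noteq> 0" using s l0 by auto
      then have "poly P 0 = monom \<alpha> 1"
        by (auto simp: P const2_def X\<^sub>1_def X\<^sub>2_def monom_altdef)
      then have "coeff (wtop l i f) 0 = monom (c * \<alpha> ^ k) k"
        unfolding top by (simp add: const2_def monom_power smult_monom flip: poly_0_coeff_0)
      then have "bcoeff (wtop l i f) k 0 \<noteq> 0" using c \<alpha> by (simp add: bcoeff_def)
      then show ?thesis using top_exp by blast
    qed
    then have "d \<le> l * i" by (simp add: d)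
    then have d': "d = l * i" using ge_i by (simp add: d_def)
    show ?thesis
    proof (rule that[OF inv])
      show "tame E'" unfolding E'_def by (rule tame_triangular)
      have supp: "m \<le> i \<and> n < l" if mn: "bcoeff (subst2 f E) m n \<noteq> 0" for m n
      proof -
        have "l * m + i * n \<le> l * i"
          using bcoeff_nonzero_imp_le_wdeg[OF mn, of l i] degE d' by linarith
        then have "l * m \<le> l * i" "i * n \<le> i * l" and le: "l * m + i * n \<le> i * l"
          using mult.commute[of l i] by linarith+
        then have "m \<le> i" "n \<le> l" using i(2) l0 by simp_all
        moreover have "n \<noteq> l"
        proof
          assume "n = l"
          with le have "m = 0" using l0 by simp
          then have "bcoeff (coeff (grade l i (subst2 f E)) d) 0 l \<noteq> 0"
            using mn \<open>n = l\<close> d' by (simp add: bcoeff_coeff_grade mult.commute)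
          then show False unfolding topE bcoeff_monomials using l0 by (simp split: if_splits)
        qed
        ultimately show ?thesis by simp
      qed
      show "wdeg 1 0 ((F \<circ>\<^sub>P E) $ 1) \<le> i"
        unfolding comp_pmap_nth f_def[symmetric] wdeg_le_iff using supp by simp
      have "wdeg 0 1 ((F \<circ>\<^sub>P E) $ 1) \<le> l - 1"
        unfolding comp_pmap_nth f_def[symmetric] wdeg_le_iff using supp by fastforce
      then show "wdeg 0 1 ((F \<circ>\<^sub>P E) $ 1) < l" using l0 by linarith
    qed
  qed
qed

text \<open>Induction on the sum of the two partial degrees of the first component; precomposing
  with the swap exchanges them, so the first may be taken as the smaller.\<close>

theorem automorphism_tame:
  fixes F :: "'a::field pmap"
  assumes "pmap_automorphism F"
  shows "tame F"
proof -
  have main: "tame F" if "F \<circ>\<^sub>P G = id_pmap" "G \<circ>\<^sub>P F = id_pmap" for F G :: "'a pmap"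
    using that
  proof (induction "wdeg 1 0 (F $ 1) + wdeg 0 1 (F $ 1)" arbitrary: F G rule: less_induct)
    case less
    have swap: "tame F'" if "tame (F' \<circ>\<^sub>P swap_pmap)" for F' :: "'a pmap"
      using tame_comp[OF that tame_swap] by (simp add: comp_pmap_assoc)
    have inv_swap: "(F \<circ>\<^sub>P swap_pmap) \<circ>\<^sub>P (swap_pmap \<circ>\<^sub>P G) = id_pmap"
      "(swap_pmap \<circ>\<^sub>P G) \<circ>\<^sub>P (F \<circ>\<^sub>P swap_pmap) = id_pmap"
      using less.prems by (metis comp_id_pmap comp_pmap_assoc swap_swap)+
    have univariate: "tame F'" if "wdeg 0 1 (F' $ 1) = 0" "F' \<circ>\<^sub>P G' = id_pmap" "G' \<circ>\<^sub>P F' = id_pmap"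
      for F' G' :: "'a pmap"
    proof -
      have "bcoeff (F' $ 1) i j = bcoeff [:coeff (F' $ 1) 0:] i j" for i j
        using bcoeff_support_bounds(2)[of "F' $ 1" i j] that(1)
        by (cases j) (auto simp: bcoeff_def)
      then have "F' $ 1 = [:coeff (F' $ 1) 0:]" by (rule bpoly_eqI)
      with that(2,3) show ?thesis by (rule tame_automorphism_univariate)
    qed
    \<comment> \<open>Stated for any \<open>F'\<close> with the same degree sum as \<open>F\<close>,
      so that it covers both \<open>F\<close> and its swapped version.\<close>
    have step: "tame F'" if FG': "F' \<circ>\<^sub>P G' = id_pmap" "G' \<circ>\<^sub>P F' = id_pmap"
      and pos: "0 < wdeg 1 0 (F' $ 1)" "wdeg 1 0 (F' $ 1) \<le> wdeg 0 1 (F' $ 1)"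
      and eq: "wdeg 1 0 (F' $ 1) + wdeg 0 1 (F' $ 1) = wdeg 1 0 (F $ 1) + wdeg 0 1 (F $ 1)"
      for F' G' :: "'a pmap"
    proof -
      obtain E E' where E: "E \<circ>\<^sub>P E' = id_pmap" "E' \<circ>\<^sub>P E = id_pmap" "tame E'"
        and deg: "wdeg 1 0 ((F' \<circ>\<^sub>P E) $ 1) \<le> wdeg 1 0 (F' $ 1)"
          "wdeg 0 1 ((F' \<circ>\<^sub>P E) $ 1) < wdeg 0 1 (F' $ 1)"
        by (rule degree_reduction[OF FG' refl pos(1) refl pos(2)])
      have "tame (F' \<circ>\<^sub>P E)"
      proof (rule less.hyps)
        show "wdeg 1 0 ((F' \<circ>\<^sub>P E) $ 1) + wdeg 0 1 ((F' \<circ>\<^sub>P E) $ 1) < wdeg 1 0 (F $ 1) + wdeg 0 1 (F $ 1)"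
          using deg eq by linarith
        show "(F' \<circ>\<^sub>P E) \<circ>\<^sub>P (E' \<circ>\<^sub>P G') = id_pmap" "(E' \<circ>\<^sub>P G') \<circ>\<^sub>P (F' \<circ>\<^sub>P E) = id_pmap"
          by (metis E(1,2) FG' comp_id_pmap comp_pmap_assoc)+
      qed
      from tame_comp[OF this E(3)] show ?thesis by (simp add: comp_pmap_assoc E)
    qed
    have deg_swap: "wdeg 1 0 ((F \<circ>\<^sub>P swap_pmap) $ 1) = wdeg 0 1 (F $ 1)"
      "wdeg 0 1 ((F \<circ>\<^sub>P swap_pmap) $ 1) = wdeg 1 0 (F $ 1)"
      by (simp_all only: comp_pmap_nth wdeg_subst2_swap)
    consider "wdeg 0 1 (F $ 1) = 0" | "wdeg 1 0 (F $ 1) = 0"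
      | "0 < wdeg 1 0 (F $ 1)" "wdeg 1 0 (F $ 1) \<le> wdeg 0 1 (F $ 1)"
      | "0 < wdeg 0 1 (F $ 1)" "wdeg 0 1 (F $ 1) \<le> wdeg 1 0 (F $ 1)" by linarith
    then show ?case
    proof cases
      case 1
      then show ?thesis using univariate less.prems by blast
    next
      case 2
      then show ?thesis by (intro swap[OF univariate[OF _ inv_swap]]) (simp only: deg_swap)
    next
      case 3
      then show ?thesis using step[OF less.prems] by blast
    next
      case 4
      then show ?thesis by (intro swap[OF step[OF inv_swap]]) (simp_all only: deg_swap add.commute)
    qed
  qed
  show ?thesis using assms main unfolding pmap_automorphism_def by blast
qed

theorem theorem9:
  fixes F :: "'a::field pmap"
  assumes "pmap_automorphism F"
    and "eval_pmap F 0 = 0"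
  shows "\<exists>\<delta>. \<delta> \<noteq> 0 \<and> det (jacobian_pmap F) = const2 \<delta> \<and>
    (\<exists>Ps. F = diag_pmap \<delta> 1 \<circ>\<^sub>P foldr (\<circ>\<^sub>P) Ps id_pmap \<and>
      (\<forall>P\<in>set Ps. pmap_automorphism P \<and> pascal_finite P \<and>
        (linear_transvection P \<or> conj_triangular P) \<and>
        (CHAR('a) > 0 \<longrightarrow> pmap_power P (CHAR('a)\<^sup>2) = id_pmap)))"
  using automorphism_tame[OF assms(1)] pmap_automorphism_conj_triangular pascal_finite_conj_triangular
    pmap_power_CHAR_conj_triangular
  unfolding tame_def by blast

end
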